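(* Let $\alpha\ge0$ and define $$D^{(\alpha)}_{\mathsf{in},n}=\sum_{(\xi,r)\in X^{(n)}}|\xi|^\alpha 1_{B^{\mathbb{T}_n}_{r}(o)}(\xi),\qquad D^{(\alpha)}_{\mathsf{in}}=\sum_{(\xi,r)\in X}|\xi|^\alpha 1_{B_{r}(o)}(\xi),$$ where $|\xi|$ is the toroidal distance to the origin $o$ in the first sum and the Euclidean norm in the second. Then $D^{(\alpha)}_{\mathsf{in},n}$ converges in distribution to $D^{(\alpha)}_{\mathsf{in}}$ as $n\to\infty$. Moreover, if $s\le d$ then $\mathbb{P}(D^{(\alpha)}_{\mathsf{in}}=\infty)=1$, whereas if $s>d$ then $D^{(0)}_{\mathsf{in}}$ is Poisson distributed with mean $\kappa_d\mathbb{E}R^d$. Finally, if $\alpha>0$ and $s>d$, then with $p^{(\alpha)}_{\mathsf{in},t}=\mathbb{P}(D^{(\alpha)}_{\mathsf{in}}>t)$, $$\lim_{t\to\infty}t^{(s-d)/\alpha}p^{(\alpha)}_{\mathsf{in},t}=\frac{d\kappa_d\beta}{s-d},$$ where $\kappa_d$ is the volume of the unit ball in $\mathbb{R}^d$.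
   Context: Fix an integer $d\ge2$. For $n\ge1$, $\mathbb{T}_n$ is the torus obtained from $[-n/2,n/2]^d$ by identifying opposite faces, with toroidal distance ${\rm d}_{\mathbb{T}_n}$; $B^{\mathbb{T}_n}_r(\xi)=\{\eta\in\mathbb{T}_n:{\rm d}_{\mathbb{T}_n}(\xi,\eta)\le r\}$ and $B_r(\xi)$ is the closed Euclidean ball in $\mathbb{R}^d$. $R$ is a nonnegative random variable with absolutely continuous distribution such that $\lim_{h\to\infty}h^s\mathbb{P}(R>h)=\beta$ for some $\beta,s\in(0,\infty)$. $X^{(n)}$ is a homogeneous Poisson point process of intensity $1$ on $\mathbb{T}_n$, each point independently marked with a mark in $[0,\infty)$ distributed as $R$ (points written $(\xi,r)$); $X$ is the analogous independently marked Poisson point process of intensity $1$ on $\mathbb{R}^d$. *)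

theory Defs
  imports "HOL-Probability.Probability"
begin

text \<open>Points of R^d are elements of real^'d (d = CARD('d)); a marked point is a pair
  (xi, r) :: (real^'d) \<times> real.  A point configuration is a set of marked points.\<close>

definition npts :: "('p set) \<Rightarrow> 'p set \<Rightarrow> enat" where
  "npts P A = (if finite (P \<inter> A) then enat (card (P \<inter> A)) else \<infinity>)"

definition poisson_prob :: "real \<Rightarrow> nat \<Rightarrow> real" where
  "poisson_prob m k = m ^ k / fact k * exp (- m)"

definition marked_intensity :: "(real^'d) set \<Rightarrow> real measure \<Rightarrow> ((real^'d) \<times> real) measure" where
  "marked_intensity W mu = (density lborel (indicator W)) \<Otimes>\<^sub>M mu"

text \<open>X is an independently marked Poisson point process (intensity 1 on W, marks i.i.d. with
  law mu) defined on the probability space M: the counts in measurable sets are Poisson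
  distributed with mean given by the intensity measure, and counts in disjoint sets are
  independent.\<close>
definition marked_poisson_pp ::
  "'a measure \<Rightarrow> ('a \<Rightarrow> ((real^'d) \<times> real) set) \<Rightarrow> (real^'d) set \<Rightarrow> real measure \<Rightarrow> bool" where
  "marked_poisson_pp M X W mu \<longleftrightarrow>
     prob_space M \<and>
     (\<forall>A \<in> sets (marked_intensity W mu).
        (\<lambda>\<omega>. npts (X \<omega>) A) \<in> measurable M (count_space UNIV)) \<and>
     (\<forall>A \<in> sets (marked_intensity W mu).
        emeasure (marked_intensity W mu) A < \<infinity> \<longrightarrow>
        (\<forall>k::nat. measure M {\<omega> \<in> space M. npts (X \<omega>) A = enat k}
                 = poisson_prob (measure (marked_intensity W mu) A) k)) \<and>
     (\<forall>(I::nat set) A. finite I \<longrightarrow> (\<forall>i\<in>I. A i \<in> sets (marked_intensity W mu)) \<longrightarrow>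
        disjoint_family_on A I \<longrightarrow>
        prob_space.indep_vars M (\<lambda>_. count_space UNIV) (\<lambda>i \<omega>. npts (X \<omega>) (A i)) I)"

text \<open>The torus T_n, represented by its fundamental domain [-n/2, n/2)^d.\<close>
definition torus_box :: "nat \<Rightarrow> (real^'d) set" where
  "torus_box n = {x. \<forall>i. - real n / 2 \<le> x $ i \<and> x $ i < real n / 2}"

text \<open>Toroidal distance on T_n (for points of the fundamental domain).\<close>
definition tor_dist :: "nat \<Rightarrow> real^'d \<Rightarrow> real^'d \<Rightarrow> real" where
  "tor_dist n x y = sqrt (\<Sum>i\<in>UNIV. (min \<bar>x $ i - y $ i\<bar> (real n - \<bar>x $ i - y $ i\<bar>))\<^sup>2)"

definition tor_ball :: "nat \<Rightarrow> real^'d \<Rightarrow> real \<Rightarrow> (real^'d) set" where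
  "tor_ball n xi r = {eta \<in> torus_box n. tor_dist n xi eta \<le> r}"

text \<open>x^a with the convention x^0 = 1 (also for x = 0).\<close>
definition pw :: "real \<Rightarrow> real \<Rightarrow> real" where
  "pw x a = (if a = 0 then 1 else x powr a)"

definition D_in_torus :: "nat \<Rightarrow> real \<Rightarrow> ((real^'d) \<times> real) set \<Rightarrow> ennreal" where
  "D_in_torus n \<alpha> P = (\<integral>\<^sup>+ p. ennreal (pw (tor_dist n 0 (fst p)) \<alpha>)
        * indicator (tor_ball n 0 (snd p)) (fst p) \<partial>count_space P)"

definition D_in :: "real \<Rightarrow> ((real^'d) \<times> real) set \<Rightarrow> ennreal" where
  "D_in \<alpha> P = (\<integral>\<^sup>+ p. ennreal (pw (norm (fst p)) \<alpha>)
        * indicator (cball 0 (snd p)) (fst p) \<partial>count_space P)"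

text \<open>Convergence in distribution of [0,\<infinity>]-valued random variables D n (on spaces M n) to D
  (on M0), i.e. weak convergence of the laws on [0,\<infinity>]: convergence of the distribution
  functions at every continuity point of the limit distribution function.\<close>
definition conv_distr_ennreal ::
  "(nat \<Rightarrow> 'a measure) \<Rightarrow> (nat \<Rightarrow> 'a \<Rightarrow> ennreal) \<Rightarrow> 'b measure \<Rightarrow> ('b \<Rightarrow> ennreal) \<Rightarrow> bool" where
  "conv_distr_ennreal M D M0 D0 \<longleftrightarrow>
     (\<forall>t::real. isCont (\<lambda>u. measure M0 {\<omega> \<in> space M0. D0 \<omega> \<le> ennreal u}) t \<longrightarrow>
        (\<lambda>n. measure (M n) {\<omega> \<in> space (M n). D n \<omega> \<le> ennreal t})
          \<longlonglongrightarrow> measure M0 {\<omega> \<in> space M0. D0 \<omega> \<le> ennreal t})"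

end

theory Submission
  imports Defs "HOL-Real_Asymp.Real_Asymp"
begin

text \<open>
  On the fundamental domain the toroidal distance to the origin is the Euclidean norm, so the
  degree on the torus is the sum over the points of \<open>X^(n)\<close> of the Euclidean weight
  \<open>f (\<xi>, r) = |\<xi>|^\<alpha> 1{|\<xi>| \<le> r}\<close>. The counts in disjoint sets determine the law of
  such a sum (approximate \<open>f\<close> from below by simple functions), so it has the same law as the
  sum over the points of \<open>X\<close> in the box, which increases to \<open>D_in\<close>.

  The mean number of points with \<open>T < |\<xi>| \<le> r\<close> is the integral of
  \<open>d \<kappa> u^(d-1) P(R \<ge> u)\<close> over \<open>u \<ge> T\<close>. It is infinite for some \<open>T \<ge> 1\<close> if \<open>s \<le> d\<close>, and
  otherwise asymptotic to \<open>d \<kappa> \<beta> T^(d-s) / (s-d)\<close>. For \<open>s > d\<close> only finitely many points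
  have positive weight, and the tail of the sum is that of its largest term: the sum exceeds
  \<open>t\<close> if one weight does; conversely, if all weights are at most \<open>t - t^(7/8)\<close>, at most one
  exceeds \<open>t^(3/4)\<close>, and at most \<open>t^(1/8)\<close> points cover the origin, then the sum is at most
  \<open>t\<close>; the last two conditions fail with negligible probability.
\<close>

subsection \<open>Poisson processes\<close>

lemma emeasure_count_space_npts: "emeasure (count_space P) (P \<inter> A) = ennreal_of_enat (npts P A)"
  by (simp add: npts_def emeasure_count_space)

lemma nn_integral_count_space_indicator_npts:
  "(\<integral>\<^sup>+p. indicator A p \<partial>count_space P) = ennreal_of_enat (npts P A)"
proof -
  have "(\<integral>\<^sup>+p. indicator A p \<partial>count_space P) = (\<integral>\<^sup>+p. indicator (P \<inter> A) p \<partial>count_space P)"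
    by (intro nn_integral_cong) (auto simp: indicator_def)
  then show ?thesis
    by (simp add: emeasure_count_space_npts nn_integral_indicator)
qed

lemma npts_mono: "A \<subseteq> B \<Longrightarrow> npts P A \<le> npts P B"
  by (auto simp: npts_def intro!: card_mono intro: finite_subset[of "P \<inter> A" "P \<inter> B"])

text \<open>Keeps from \<open>marked_poisson_pp\<close> only an intensity measure \<open>N\<close>
  on an arbitrary space of points, so that one theory serves the processes on the boxes and the one
  on the whole space.\<close>

locale poisson_process = prob_space M
  for M :: "'a measure" and X :: "'a \<Rightarrow> 'p set" and N :: "'p measure" +
  assumes npts_measurable:
      "A \<in> sets N \<Longrightarrow> (\<lambda>\<omega>. npts (X \<omega>) A) \<in> measurable M (count_space UNIV)"
    and prob_npts: "\<lbrakk>A \<in> sets N; emeasure N A < \<infinity>\<rbrakk> \<Longrightarrow>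
      prob {\<omega> \<in> space M. npts (X \<omega>) A = enat k} = poisson_prob (measure N A) k"
    and indep_npts: "\<lbrakk>finite (I :: nat set); \<And>i. i \<in> I \<Longrightarrow> B i \<in> sets N; disjoint_family_on B I\<rbrakk> \<Longrightarrow>
      indep_vars (\<lambda>_. count_space UNIV) (\<lambda>i \<omega>. npts (X \<omega>) (B i)) I"

lemma poisson_process_marked:
  "marked_poisson_pp M X W mu \<Longrightarrow> poisson_process M X (marked_intensity W mu)"
  unfolding marked_poisson_pp_def poisson_process_def poisson_process_axioms_def by blast

text \<open>A set of intensity 0 almost surely contains no points, so the rate 0 stands for the
  point mass at 0.\<close>

definition poisson_law :: "real \<Rightarrow> nat pmf" where
  "poisson_law m = (if m > 0 then poisson_pmf m else return_pmf 0)"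

lemma pmf_poisson_law: "0 \<le> m \<Longrightarrow> pmf (poisson_law m) k = poisson_prob m k"
  by (cases "m = 0") (auto simp: poisson_law_def poisson_prob_def power_0_left)

context poisson_process
begin

text \<open>The process prescribes the probability of each finite count. The Poisson weights sum to
  1, so the value \<open>\<infinity>\<close> gets no mass and the whole law on \<open>enat\<close>
  is determined.\<close>

lemma npts_law:
  assumes "A \<in> sets N" "emeasure N A < \<infinity>"
  shows "distr M (count_space UNIV) (\<lambda>\<omega>. npts (X \<omega>) A) =
    distr (measure_pmf (poisson_law (measure N A))) (count_space UNIV) enat" (is "?L = ?R")
proof (rule measure_eqI_countable_AE)
  note [measurable] = npts_measurable[OF assms(1)]
  interpret L: prob_space ?L by (intro prob_space_distr) simp
  have pt: "measure ?L {enat k} = measure ?R {enat k}" for k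
  proof -
    have "measure ?L {enat k} = prob {\<omega> \<in> space M. npts (X \<omega>) A = enat k}"
      by (subst measure_distr) (auto intro!: arg_cong[where f=prob])
    also have "\<dots> = pmf (poisson_law (measure N A)) k"
      by (simp only: prob_npts[OF assms] pmf_poisson_law measure_nonneg)
    also have "\<dots> = measure ?R {enat k}"
      by (subst measure_distr) (auto simp: pmf.rep_eq intro!: arg_cong[where f="measure _"])
    finally show ?thesis .
  qed
  show ptm: "emeasure ?L {x} = emeasure ?R {x}" if "x \<in> range enat" for x
    using that pt by (auto simp: L.emeasure_eq_measure measure_pmf.emeasure_eq_measure
        emeasure_eq_measure emeasure_distr measure_distr)
  \<comment> \<open>Both laws agree on the countably many finite values, which carry the full mass
    of the right-hand one.\<close>
  have "emeasure ?L (range enat) = (\<integral>\<^sup>+x. emeasure ?L {x} \<partial>count_space (range enat))"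
    by (rule emeasure_countable_singleton) auto
  also have "\<dots> = (\<integral>\<^sup>+x. emeasure ?R {x} \<partial>count_space (range enat))"
    by (intro nn_integral_cong) (simp add: ptm)
  also have "\<dots> = emeasure ?R (range enat)"
    by (rule emeasure_countable_singleton[symmetric]) auto
  also have "\<dots> = 1"
    by (subst emeasure_distr) (auto simp: vimage_def)
  finally have "L.prob (range enat) = 1"
    by (simp add: L.emeasure_eq_measure)
  then have "AE x in ?L. x \<in> range enat"
    by (subst (asm) L.prob_eq_1) auto
  then show "AE x in ?L. x \<in> range enat" .
  show "AE x in ?R. x \<in> range enat"
    by (subst AE_distr_iff) auto
qed auto

lemma prob_npts_pred:
  assumes "A \<in> sets N" "emeasure N A < \<infinity>"
  shows "prob {\<omega> \<in> space M. Q (npts (X \<omega>) A)} =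
    measure (measure_pmf (poisson_law (measure N A))) {k. Q (enat k)}"
proof -
  note [measurable] = npts_measurable[OF assms(1)]
  have "prob {\<omega> \<in> space M. Q (npts (X \<omega>) A)} = measure (distr M (count_space UNIV) (\<lambda>\<omega>. npts (X \<omega>) A)) {x. Q x}"
    by (subst measure_distr) (auto intro!: arg_cong[where f=prob])
  then show ?thesis
    unfolding npts_law[OF assms] by (simp add: measure_distr vimage_def)
qed

text \<open>The definition of a Poisson process does not exclude points of \<open>X \<omega>\<close> outside \<open>space N\<close>.\<close>
lemma nn_integral_points_measurable:
  assumes "f \<in> borel_measurable N"
  shows "(\<lambda>\<omega>. \<integral>\<^sup>+p. f p * indicator (space N) p \<partial>count_space (X \<omega>)) \<in> borel_measurable M"
  using assms
proof (induction rule: borel_measurable_induct)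
  \<comment> \<open>Functions that agree on \<open>space N\<close> may differ at points of
    \<open>X \<omega>\<close> outside it; the factor \<open>indicator (space N)\<close> removes
    these.\<close>
  case (cong f g)
  moreover have "(\<integral>\<^sup>+p. f p * indicator (space N) p \<partial>count_space (X \<omega>)) =
      (\<integral>\<^sup>+p. g p * indicator (space N) p \<partial>count_space (X \<omega>))" for \<omega>
    using cong by (intro nn_integral_cong) (auto simp: indicator_def)
  ultimately show ?case by simp
next
  \<comment> \<open>For an indicator the integral is a count, which is measurable by assumption;
    linearity and monotone convergence do the rest.\<close>
  case (set A)
  have "(\<integral>\<^sup>+p. indicator A p * indicator (space N) p \<partial>count_space (X \<omega>)) = ennreal_of_enat (npts (X \<omega>) A)" for \<omega>
    unfolding nn_integral_count_space_indicator_npts[symmetric]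
    using sets.sets_into_space[OF set] by (intro nn_integral_cong) (auto simp: indicator_def)
  moreover have "(\<lambda>\<omega>. ennreal_of_enat (npts (X \<omega>) A)) \<in> borel_measurable M"
    by (rule measurable_compose[OF npts_measurable[OF set]]) simp
  ultimately show ?case by simp
next
  case (mult u c)
  then show ?case by (simp add: nn_integral_cmult mult.assoc)
next
  case (add u v)
  then show ?case by (simp add: nn_integral_add distrib_right)
next
  case (seq U)
  have "(\<integral>\<^sup>+p. (SUP i. U i) p * indicator (space N) p \<partial>count_space (X \<omega>)) =
     (SUP i. \<integral>\<^sup>+p. U i p * indicator (space N) p \<partial>count_space (X \<omega>))" for \<omega>
  proof -
    have "(\<integral>\<^sup>+p. (SUP i. U i) p * indicator (space N) p \<partial>count_space (X \<omega>)) =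
      (\<integral>\<^sup>+p. (SUP i. U i p * indicator (space N) p) \<partial>count_space (X \<omega>))"
      by (intro nn_integral_cong) (simp add: SUP_mult_right_ennreal image_comp)
    also have "\<dots> = (SUP i. \<integral>\<^sup>+p. U i p * indicator (space N) p \<partial>count_space (X \<omega>))"
      using \<open>incseq U\<close> by (intro nn_integral_monotone_convergence_SUP)
        (auto simp: incseq_def le_fun_def intro!: mult_right_mono)
    finally show ?thesis .
  qed
  moreover have "(\<lambda>\<omega>. SUP i. \<integral>\<^sup>+p. U i p * indicator (space N) p \<partial>count_space (X \<omega>)) \<in> borel_measurable M"
    using seq by (intro borel_measurable_SUP) auto
  ultimately show ?case by (simp add: image_comp)
qed

end

section \<open>Estimates for Poisson counts\<close>

lemma poisson_prob_tendsto_0: "((\<lambda>m. poisson_prob m k) \<longlongrightarrow> 0) at_top"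
proof -
  have "((\<lambda>m::real. m ^ k / exp m / fact k) \<longlongrightarrow> 0 / fact k) at_top"
    by (intro tendsto_divide tendsto_power_div_exp_0 tendsto_const) simp
  then show ?thesis
    by (simp add: poisson_prob_def exp_minus field_simps)
qed

text \<open>Chernoff bound with parameter 1: a Poisson variable Z of mean m satisfies E e^Z = e^((e
  - 1) m), and the indicator of Z > K is at most e^(Z - K).\<close>

lemma poisson_law_tail_le:
  assumes "0 \<le> m"
  shows "measure (measure_pmf (poisson_law m)) {k. K < k} \<le> exp ((exp 1 - 1) * m - real K)"
proof -
  have sums: "(\<lambda>k. poisson_prob m k * exp (real k - real K)) sums exp ((exp 1 - 1) * m - real K)"
  proof -
    have "(\<lambda>k. exp (- m - real K) * ((exp 1 * m) ^ k /\<^sub>R fact k)) sums (exp (- m - real K) * exp (exp 1 * m))"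
      by (intro sums_mult exp_converges)
    moreover have "exp (- m - real K) * ((exp 1 * m) ^ k /\<^sub>R fact k) = poisson_prob m k * exp (real k - real K)" for k
      by (simp add: poisson_prob_def power_mult_distrib exp_diff exp_minus field_simps exp_of_nat_mult[symmetric])
    moreover have "exp (- m - real K) * exp (exp 1 * m) = exp ((exp 1 - 1) * m - real K)"
      by (simp add: exp_add[symmetric] algebra_simps)
    ultimately show ?thesis by simp
  qed
  have nonneg: "0 \<le> poisson_prob m k * exp (real k - real K)" for k
    using assms by (simp add: poisson_prob_def)
  have "emeasure (measure_pmf (poisson_law m)) {k. K < k} =
      (\<integral>\<^sup>+k. indicator {k. K < k} k \<partial>measure_pmf (poisson_law m))"
    by simp
  also have "\<dots> \<le> (\<integral>\<^sup>+k. ennreal (exp (real k - real K)) \<partial>measure_pmf (poisson_law m))"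
    by (intro nn_integral_mono) (auto simp: indicator_def)
  also have "\<dots> = (\<Sum>k. ennreal (poisson_prob m k * exp (real k - real K)))"
    using assms by (subst nn_integral_measure_pmf)
      (simp add: nn_integral_count_space_nat pmf_poisson_law ennreal_mult'' )
  also have "\<dots> = ennreal (exp ((exp 1 - 1) * m - real K))"
    using sums nonneg by (subst suminf_ennreal2) (auto simp: sums_iff)
  finally show ?thesis
    by (simp add: measure_pmf.emeasure_eq_measure)
qed

context poisson_process
begin

lemma prob_npts_ge_1:
  assumes "A \<in> sets N" "emeasure N A < \<infinity>"
  shows "prob {\<omega> \<in> space M. 1 \<le> npts (X \<omega>) A} = 1 - exp (- measure N A)"
proof -
  have "{k. 1 \<le> enat k} = - {0}" by (auto simp: one_enat_def)
  then have "prob {\<omega> \<in> space M. 1 \<le> npts (X \<omega>) A} = 1 - pmf (poisson_law (measure N A)) 0"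
    by (simp add: prob_npts_pred[OF assms] measure_pmf.prob_compl[of "{0}", simplified, folded Compl_eq_Diff_UNIV]
        pmf.rep_eq)
  then show ?thesis by (simp add: pmf_poisson_law poisson_prob_def)
qed

text \<open>Follows from 1 - (1 + m) e^(-m) and e^(-m) \<ge> 1 - m. The quadratic order makes two
  large terms in a sum negligible against one.\<close>

lemma prob_npts_ge_2_le:
  assumes "A \<in> sets N" "emeasure N A < \<infinity>"
  shows "prob {\<omega> \<in> space M. 2 \<le> npts (X \<omega>) A} \<le> (measure N A)\<^sup>2"
proof -
  let ?m = "measure N A" let ?p = "poisson_law ?m"
  have "{k. 2 \<le> enat k} = - {0, 1}" by (auto simp: numeral_eq_enat)
  then have "prob {\<omega> \<in> space M. 2 \<le> npts (X \<omega>) A} = 1 - measure ?p {0, 1}"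
    using measure_pmf.prob_compl[of "{0, 1}" ?p] by (simp add: prob_npts_pred[OF assms] Compl_eq_Diff_UNIV)
  also have "measure ?p {0, 1} = exp (- ?m) * (1 + ?m)"
    by (subst measure_measure_pmf_finite) (auto simp: pmf_poisson_law poisson_prob_def algebra_simps)
  also have "1 - exp (- ?m) * (1 + ?m) \<le> 1 - (1 - ?m) * (1 + ?m)"
    using exp_ge_add_one_self[of "- ?m"] by (intro diff_left_mono mult_right_mono) auto
  finally show ?thesis by (simp add: power2_eq_square algebra_simps)
qed

lemma prob_npts_gt_le:
  assumes "A \<in> sets N" "emeasure N A < \<infinity>"
  shows "prob {\<omega> \<in> space M. enat K < npts (X \<omega>) A} \<le> exp ((exp 1 - 1) * measure N A - real K)"
  using poisson_law_tail_le[of "measure N A" K] by (simp add: prob_npts_pred[OF assms])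

text \<open>The process prescribes laws only for sets of finite intensity, so \<open>A\<close> is
  exhausted by such sets. Their means tend to infinity, hence any fixed bound on the number of
  points has probability 0.\<close>

lemma prob_npts_eq_infinity:
  assumes "sigma_finite_measure N" and A: "A \<in> sets N" "emeasure N A = \<infinity>"
  shows "prob {\<omega> \<in> space M. npts (X \<omega>) A = \<infinity>} = 1"
proof -
  interpret N: sigma_finite_measure N by fact
  obtain B where B: "range B \<subseteq> sets N" "\<Union>(range B) = space N" "\<And>i. emeasure N (B i) \<noteq> \<infinity>" "incseq B"
    using N.sigma_finite_incseq by blast
  have AB: "A \<inter> B i \<in> sets N" "emeasure N (A \<inter> B i) < \<infinity>" for i
  proof -
    show "A \<inter> B i \<in> sets N" using A B(1) by auto
    have "emeasure N (A \<inter> B i) \<le> emeasure N (B i)" using B(1) by (intro emeasure_mono) auto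
    then show "emeasure N (A \<inter> B i) < \<infinity>" using B(3)[of i] by (auto simp: less_top top_unique)
  qed
  have "(\<lambda>i. emeasure N (A \<inter> B i)) \<longlonglongrightarrow> emeasure N (\<Union>i. A \<inter> B i)"
    using AB B(4) by (intro Lim_emeasure_incseq) (fastforce simp: incseq_def)+
  also have "(\<Union>i. A \<inter> B i) = A"
    using B(2) sets.sets_into_space[OF A(1)] by auto
  finally have lim: "(\<lambda>i. ennreal (measure N (A \<inter> B i))) \<longlonglongrightarrow> \<infinity>"
    using AB(2) A(2) by (simp add: emeasure_eq_ennreal_measure less_top)
  have top: "filterlim (\<lambda>i. measure N (A \<inter> B i)) at_top sequentially"
    unfolding filterlim_at_top_dense
  proof
    fix Z :: real
    have "\<forall>\<^sub>F i in sequentially. ennreal Z < ennreal (measure N (A \<inter> B i))"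
      using order_tendstoD(1)[OF lim, of "ennreal Z"] by simp
    then show "\<forall>\<^sub>F i in sequentially. Z < measure N (A \<inter> B i)"
      by eventually_elim (metis ennreal_leI linorder_not_less)
  qed
  \<comment> \<open>At most \<open>K\<close> points in \<open>A\<close> means at most
    \<open>K\<close> points in every \<open>A \<inter> B i\<close>, and the probability of the
    latter tends to 0 as the mean grows.\<close>
  have zero: "prob {\<omega> \<in> space M. npts (X \<omega>) A \<le> enat K} = 0" for K
  proof (rule antisym)
    have "prob {\<omega> \<in> space M. npts (X \<omega>) A \<le> enat K} \<le> (\<Sum>k\<le>K. poisson_prob (measure N (A \<inter> B i)) k)" for i
    proof -
      note [measurable] = npts_measurable[OF AB(1)[of i]]
      have "prob {\<omega> \<in> space M. npts (X \<omega>) A \<le> enat K} \<le> prob {\<omega> \<in> space M. npts (X \<omega>) (A \<inter> B i) \<le> enat K}"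
        using npts_mono[of "A \<inter> B i" A] by (intro finite_measure_mono) (auto intro: order_trans)
      also have "\<dots> = measure (measure_pmf (poisson_law (measure N (A \<inter> B i)))) {..K}"
        by (subst prob_npts_pred[OF AB]) (simp add: atMost_def)
      also have "\<dots> = (\<Sum>k\<le>K. poisson_prob (measure N (A \<inter> B i)) k)"
        by (subst measure_measure_pmf_finite) (auto simp: pmf_poisson_law)
      finally show ?thesis .
    qed
    moreover have "(\<lambda>i. \<Sum>k\<le>K. poisson_prob (measure N (A \<inter> B i)) k) \<longlonglongrightarrow> (\<Sum>k\<le>K. 0)"
      by (intro tendsto_sum filterlim_compose[OF poisson_prob_tendsto_0 top])
    ultimately show "prob {\<omega> \<in> space M. npts (X \<omega>) A \<le> enat K} \<le> 0"
      by (intro LIMSEQ_le_const) auto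
  qed simp
  note [measurable] = npts_measurable[OF A(1)]
  have "AE \<omega> in M. \<not> npts (X \<omega>) A \<le> enat K" for K
    using zero[of K] by (subst AE_iff_measurable[OF _ refl]) (auto simp: emeasure_eq_measure)
  then have "AE \<omega> in M. \<forall>K. \<not> npts (X \<omega>) A \<le> enat K"
    by (simp add: AE_all_countable)
  then have "AE \<omega> in M. npts (X \<omega>) A = \<infinity>"
    by eventually_elim (metis not_infinity_eq order_refl)
  then show ?thesis
    by (subst prob_Collect_eq_1) auto
qed

text \<open>Independence makes the joint law of the counts a product of Poisson laws, which depends
  on the process only through the numbers \<open>measure N (B i)\<close>.\<close>

lemma prob_npts_joint:
  fixes n :: nat and B :: "nat \<Rightarrow> 'p set"
  defines "P \<equiv> (\<Pi>\<^sub>M i\<in>{..<n}. count_space (UNIV :: enat set))"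
  assumes "n > 0" and B: "\<And>i. i < n \<Longrightarrow> B i \<in> sets N" "\<And>i. i < n \<Longrightarrow> emeasure N (B i) < \<infinity>"
    and disj: "disjoint_family_on B {..<n}"
    and S: "S \<in> sets P"
  shows "prob {\<omega> \<in> space M. (\<lambda>i\<in>{..<n}. npts (X \<omega>) (B i)) \<in> S} =
    measure (\<Pi>\<^sub>M i\<in>{..<n}. distr (measure_pmf (poisson_law (measure N (B i)))) (count_space UNIV) enat) S"
proof -
  have meas: "(\<lambda>\<omega>. \<lambda>i\<in>{..<n}. npts (X \<omega>) (B i)) \<in> measurable M P"
    unfolding P_def by (intro measurable_restrict npts_measurable B) auto
  have "distr M P (\<lambda>\<omega>. \<lambda>i\<in>{..<n}. npts (X \<omega>) (B i)) =
      (\<Pi>\<^sub>M i\<in>{..<n}. distr M (count_space UNIV) (\<lambda>\<omega>. npts (X \<omega>) (B i)))"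
    unfolding P_def using \<open>n > 0\<close> B(1) disj
    by (intro indep_vars_iff_distr_eq_PiM'[THEN iffD1] indep_npts npts_measurable) auto
  also have "\<dots> = (\<Pi>\<^sub>M i\<in>{..<n}. distr (measure_pmf (poisson_law (measure N (B i)))) (count_space UNIV) enat)"
    using B by (intro PiM_cong npts_law) auto
  finally have "distr M P (\<lambda>\<omega>. \<lambda>i\<in>{..<n}. npts (X \<omega>) (B i)) =
      (\<Pi>\<^sub>M i\<in>{..<n}. distr (measure_pmf (poisson_law (measure N (B i)))) (count_space UNIV) enat)" .
  moreover have "{\<omega> \<in> space M. (\<lambda>i\<in>{..<n}. npts (X \<omega>) (B i)) \<in> S} =
      (\<lambda>\<omega>. \<lambda>i\<in>{..<n}. npts (X \<omega>) (B i)) -` S \<inter> space M"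
    by auto
  ultimately show ?thesis
    using measure_distr[OF meas S] by simp
qed

end

section \<open>Equality in law of sums over two processes\<close>

text \<open>The sum of a simple function is a finite combination of the counts in its level sets.
  For nonzero values these are disjoint sets of equal finite intensity, so the joint laws of the
  counts coincide. Agreement is asked only where \<open>g\<close> is nonzero, so that a box can be
  compared with the whole space.\<close>

lemma simple_points_cdf_eq:
  assumes "poisson_process M1 X1 N1" "poisson_process M2 X2 N2" and sets_eq: "sets N1 = sets N2"
    and g: "simple_function N1 g"
    and N: "\<And>A. A \<in> sets N1 \<Longrightarrow> A \<subseteq> {p. g p \<noteq> 0} \<Longrightarrow> emeasure N1 A = emeasure N2 A \<and> emeasure N1 A < \<infinity>"
  shows "measure M1 {\<omega> \<in> space M1. (\<integral>\<^sup>+p. g p * indicator (space N1) p \<partial>count_space (X1 \<omega>)) \<le> t} =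
    measure M2 {\<omega> \<in> space M2. (\<integral>\<^sup>+p. g p * indicator (space N1) p \<partial>count_space (X2 \<omega>)) \<le> t}"
proof -
  interpret P1: poisson_process M1 X1 N1 by fact
  interpret P2: poisson_process M2 X2 N2 by fact
  \<comment> \<open>The value 0 is left out: its level set contributes nothing to the sum, and the
    two intensities may differ or be infinite there.\<close>
  define Y where "Y = g ` space N1 - {0}"
  have "finite Y" using g by (simp add: Y_def simple_function_def)
  \<comment> \<open>The values are numbered because \<open>indep_npts\<close> speaks of families
    indexed by naturals.\<close>
  then obtain h where h: "bij_betw h {0..<card Y} Y" using ex_bij_betw_nat_finite by blast
  define n where "n = card Y"
  define B where "B i = g -` {h i} \<inter> space N1" for i
  have h: "bij_betw h {..<n} Y" using h by (simp add: n_def atLeast0LessThan)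
  have hY: "h i \<in> Y" if "i < n" for i using h that by (auto simp: bij_betw_def)
  have B: "B i \<in> sets N1" for i
    unfolding B_def using g by (rule simple_functionD)
  have Bsub: "B i \<subseteq> {p. g p \<noteq> 0}" if "i < n" for i
    using hY[OF that] by (auto simp: B_def Y_def)
  have disj: "disjoint_family_on B {..<n}"
    using h by (auto simp: disjoint_family_on_def B_def bij_betw_def inj_on_def)
  have decomp: "g p * indicator (space N1) p = (\<Sum>i<n. h i * indicator (B i) p)" for p
  proof -
    have "(\<Sum>i<n. h i * indicator (B i) p) = (\<Sum>y\<in>Y. y * indicator (g -` {y} \<inter> space N1) p)"
      unfolding B_def using sum.reindex_bij_betw[OF h, of "\<lambda>y. y * indicator (g -` {y} \<inter> space N1) p"] .
    also have "\<dots> = (\<Sum>y\<in>Y. if y = g p then g p * indicator (space N1) p else 0)"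
      by (intro sum.cong) (auto simp: indicator_def)
    also have "\<dots> = g p * indicator (space N1) p"
      using \<open>finite Y\<close> by (auto simp: sum.delta Y_def indicator_def)
    finally show ?thesis ..
  qed
  have int: "(\<integral>\<^sup>+p. g p * indicator (space N1) p \<partial>count_space P) = (\<Sum>i<n. h i * ennreal_of_enat (npts P (B i)))" for P
    unfolding decomp by (subst nn_integral_sum) (auto simp: nn_integral_cmult nn_integral_count_space_indicator_npts)
  show ?thesis
  \<comment> \<open>Without nonzero values both sums are 0 and both events are certain; otherwise
    the index set is nonempty, as \<open>prob_npts_joint\<close> requires.\<close>
  proof (cases "n = 0")
    case True
    then show ?thesis
      by (simp add: int P1.prob_space P2.prob_space)
  next
    case False
    \<comment> \<open>The event becomes a condition on the vector of counts, the same for both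
      processes.\<close>
    define S where "S = {v \<in> space (\<Pi>\<^sub>M i\<in>{..<n}. count_space (UNIV :: enat set)). (\<Sum>i<n. h i * ennreal_of_enat (v i)) \<le> t}"
    have "(\<lambda>v. \<Sum>i<n. h i * ennreal_of_enat (v i)) \<in> borel_measurable (\<Pi>\<^sub>M i\<in>{..<n}. count_space (UNIV :: enat set))"
    proof (intro borel_measurable_sum borel_measurable_times_ennreal borel_measurable_const)
      fix i assume "i \<in> {..<n}"
      then show "(\<lambda>v. ennreal_of_enat (v i)) \<in> borel_measurable (\<Pi>\<^sub>M i\<in>{..<n}. count_space (UNIV :: enat set))"
        by (intro measurable_compose[OF measurable_component_singleton]) auto
    qed
    then have S: "S \<in> sets (\<Pi>\<^sub>M i\<in>{..<n}. count_space (UNIV :: enat set))"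
      unfolding S_def by measurable
    have ev: "{\<omega> \<in> space M. (\<integral>\<^sup>+p. g p * indicator (space N1) p \<partial>count_space (X \<omega>)) \<le> t} =
      {\<omega> \<in> space M. (\<lambda>i\<in>{..<n}. npts (X \<omega>) (B i)) \<in> S}" for M :: "'x measure" and X
      by (auto simp: S_def int space_PiM)
    have fin: "measure N1 (B i) = measure N2 (B i)" "emeasure N1 (B i) < \<infinity>" "emeasure N2 (B i) < \<infinity>" if "i < n" for i
      using N[OF B Bsub[OF that]] by (auto simp: measure_def)
    have B2: "B i \<in> sets N2" for i using B sets_eq by simp
    have "(\<Pi>\<^sub>M i\<in>{..<n}. distr (measure_pmf (poisson_law (measure N1 (B i)))) (count_space UNIV) enat) =
        (\<Pi>\<^sub>M i\<in>{..<n}. distr (measure_pmf (poisson_law (measure N2 (B i)))) (count_space UNIV) enat)"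
      using fin by (intro PiM_cong) auto
    moreover have "P1.prob {\<omega> \<in> space M1. (\<lambda>i\<in>{..<n}. npts (X1 \<omega>) (B i)) \<in> S} =
      measure (\<Pi>\<^sub>M i\<in>{..<n}. distr (measure_pmf (poisson_law (measure N1 (B i)))) (count_space UNIV) enat) S"
      using False fin B disj S by (intro P1.prob_npts_joint) auto
    moreover have "P2.prob {\<omega> \<in> space M2. (\<lambda>i\<in>{..<n}. npts (X2 \<omega>) (B i)) \<in> S} =
      measure (\<Pi>\<^sub>M i\<in>{..<n}. distr (measure_pmf (poisson_law (measure N2 (B i)))) (count_space UNIV) enat) S"
      using False fin B2 disj S by (intro P2.prob_npts_joint) auto
    ultimately show ?thesis
      unfolding ev by simp
  qed
qed

text \<open>With simple functions \<open>g i\<close> increasing to \<open>f\<close>, the events that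
  the sum of \<open>g i\<close> is at most \<open>t\<close> decrease to the event for
  \<open>f\<close>. Both probabilities are therefore limits of one and the same sequence.\<close>

lemma nn_integral_points_cdf_eq:
  assumes P1: "poisson_process M1 X1 N1" and P2: "poisson_process M2 X2 N2" and sets_eq: "sets N1 = sets N2"
    and f: "f \<in> borel_measurable N1"
    and N: "\<And>A. A \<in> sets N1 \<Longrightarrow> A \<subseteq> {p. f p \<noteq> 0} \<Longrightarrow> emeasure N1 A = emeasure N2 A \<and> emeasure N1 A < \<infinity>"
  shows "measure M1 {\<omega> \<in> space M1. (\<integral>\<^sup>+p. f p * indicator (space N1) p \<partial>count_space (X1 \<omega>)) \<le> t} =
    measure M2 {\<omega> \<in> space M2. (\<integral>\<^sup>+p. f p * indicator (space N1) p \<partial>count_space (X2 \<omega>)) \<le> t}"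
proof -
  obtain g where g: "\<And>i. simple_function N1 (g i)" "incseq g" "\<And>x. (SUP i. g i x) = f x"
    using borel_measurable_implies_simple_function_sequence'[OF f] by metis
  \<comment> \<open>As \<open>g i\<close> lies below \<open>f\<close>, it vanishes wherever
    \<open>f\<close> does, so the assumption on the intensities passes to it.\<close>
  have gN: "emeasure N1 A = emeasure N2 A \<and> emeasure N1 A < \<infinity>"
    if "A \<in> sets N1" "A \<subseteq> {p. g i p \<noteq> 0}" for A i
  proof (rule N[OF that(1)])
    have "g i p \<le> f p" for p using g(3)[of p] by (metis SUP_upper UNIV_I)
    then show "A \<subseteq> {p. f p \<noteq> 0}" using that(2) by (metis (mono_tags, lifting) le_zero_eq mem_Collect_eq subset_eq)
  qed
  \<comment> \<open>Stated for any process with the same measurable sets of points, so that it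
    applies to both.\<close>
  have lim: "(\<lambda>i. measure M {\<omega> \<in> space M. (\<integral>\<^sup>+p. g i p * indicator (space N1) p \<partial>count_space (X \<omega>)) \<le> t})
     \<longlonglongrightarrow> measure M {\<omega> \<in> space M. (\<integral>\<^sup>+p. f p * indicator (space N1) p \<partial>count_space (X \<omega>)) \<le> t}"
    if "poisson_process M X N'" "sets N' = sets N1" for M :: "'x measure" and X N'
  proof -
    interpret poisson_process M X N' by fact
    have sp: "space N' = space N1" using that(2) by (rule sets_eq_imp_space_eq)
    have mono: "incseq (\<lambda>i p. g i p * indicator (space N1) p)"
      using g(2) by (auto simp: incseq_def le_fun_def intro!: mult_right_mono)
    have sup: "(\<integral>\<^sup>+p. f p * indicator (space N1) p \<partial>count_space P) =
      (SUP i. \<integral>\<^sup>+p. g i p * indicator (space N1) p \<partial>count_space P)" for P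
      using mono unfolding g(3)[symmetric]
      by (subst nn_integral_monotone_convergence_SUP[symmetric]) (auto simp: SUP_mult_right_ennreal)
    have meas: "(\<lambda>\<omega>. \<integral>\<^sup>+p. g i p * indicator (space N1) p \<partial>count_space (X \<omega>)) \<in> borel_measurable M" for i
    proof -
      have "g i \<in> borel_measurable N'"
        using borel_measurable_simple_function[OF g(1)[of i]] that(2)
        by (simp cong: measurable_cong_sets)
      from nn_integral_points_measurable[OF this] show ?thesis
        by (simp add: sp)
    qed
    let ?A = "\<lambda>i. {\<omega> \<in> space M. (\<integral>\<^sup>+p. g i p * indicator (space N1) p \<partial>count_space (X \<omega>)) \<le> t}"
    have "(\<lambda>i. prob (?A i)) \<longlonglongrightarrow> prob (\<Inter>i. ?A i)"
    proof (rule finite_Lim_measure_decseq)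
      show "range ?A \<subseteq> events" using meas by auto
      have "(\<integral>\<^sup>+p. g i p * indicator (space N1) p \<partial>count_space P) \<le> (\<integral>\<^sup>+p. g j p * indicator (space N1) p \<partial>count_space P)"
        if "i \<le> j" for i j P
        using incseqD[OF mono that] by (intro nn_integral_mono) (auto simp: le_fun_def)
      then show "decseq ?A"
        by (auto simp: decseq_def intro: order_trans)
    qed
    also have "(\<Inter>i. ?A i) = {\<omega> \<in> space M. (\<integral>\<^sup>+p. f p * indicator (space N1) p \<partial>count_space (X \<omega>)) \<le> t}"
      unfolding sup by (auto simp: SUP_le_iff)
    finally show ?thesis .
  qed
  have "measure M1 {\<omega> \<in> space M1. (\<integral>\<^sup>+p. g i p * indicator (space N1) p \<partial>count_space (X1 \<omega>)) \<le> t} =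
    measure M2 {\<omega> \<in> space M2. (\<integral>\<^sup>+p. g i p * indicator (space N1) p \<partial>count_space (X2 \<omega>)) \<le> t}" for i
    by (rule simple_points_cdf_eq[OF P1 P2 sets_eq g(1) gN])
  with lim[OF P1 refl] lim[OF P2 sets_eq[symmetric]] show ?thesis
    by (auto intro: LIMSEQ_unique)
qed

subsection \<open>The intensity of points far from the origin\<close>

text \<open>For \<alpha> > 0 and t > 0 the points of weight above \<open>t\<close> form this set
  with \<open>T = t powr (1 / \<alpha>)\<close>; for \<open>T \<ge> 1\<close> all its points have
  weight at least 1.\<close>

definition far_points :: "real \<Rightarrow> ((real^'d) \<times> real) set" where
  "far_points T = {p. T < norm (fst p) \<and> norm (fst p) \<le> snd p}"

text \<open>The weight vanishes off this set for every \<alpha>, and for \<alpha> = 0 it is the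
  indicator of the set.\<close>

definition covering_points :: "((real^'d) \<times> real) set" where
  "covering_points = {p. norm (fst p) \<le> snd p}"

lemma covering_points_sets: "covering_points \<in> sets (borel :: ((real^'d) \<times> real) measure)"
  unfolding covering_points_def by (intro borel_closed closed_Collect_le continuous_intros)

lemma emeasure_lborel_cball_0:
  assumes "0 \<le> r"
  shows "emeasure lborel (cball (0::real^'d) r) = ennreal (measure lborel (cball (0::real^'d) 1) * r ^ CARD('d))"
proof -
  have "measure lborel (cball (0::real^'d) 1) = unit_ball_vol (real CARD('d))"
    using content_cball[of 1 "0::real^'d"] by simp
  then show ?thesis
    using emeasure_cball[OF assms, of "0::real^'d"] by simp
qed

text \<open>Fundamental theorem of calculus for \<kappa> u^d, the volume of a ball of radius u. The
  integral form allows the order of integration over radius and mark to be exchanged.\<close>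

lemma emeasure_lborel_shell:
  assumes "0 \<le> T"
  shows "emeasure lborel {x::real^'d. T < norm x \<and> norm x \<le> r} =
    (\<integral>\<^sup>+u. ennreal (measure lborel (cball (0::real^'d) 1) * (real CARD('d) * u ^ (CARD('d) - 1))) * indicator {T..r} u \<partial>lborel)"
    (is "_ = (\<integral>\<^sup>+u. ennreal (?k * _) * _ \<partial>lborel)")
proof (cases "T \<le> r")
  case True
  have "{x::real^'d. T < norm x \<and> norm x \<le> r} = cball 0 r - cball 0 T"
    by auto
  also have "emeasure lborel \<dots> = emeasure lborel (cball (0::real^'d) r) - emeasure lborel (cball (0::real^'d) T)"
    using True assms by (intro emeasure_Diff) (auto simp: emeasure_lborel_cball_0)
  also have "\<dots> = ennreal (?k * r ^ CARD('d) - ?k * T ^ CARD('d))"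
    using True assms by (simp add: emeasure_lborel_cball_0 ennreal_minus)
  also have "\<dots> = (\<integral>\<^sup>+u. ennreal (?k * (real CARD('d) * u ^ (CARD('d) - 1))) * indicator {T..r} u \<partial>lborel)"
    using True assms
    by (intro nn_integral_FTC_Icc[symmetric, where F="\<lambda>u. ?k * u ^ CARD('d)"])
      (auto intro!: derivative_eq_intros)
  finally show ?thesis .
next
  case False
  then have "{x::real^'d. T < norm x \<and> norm x \<le> r} = {}" by auto
  with False show ?thesis by (simp del: Collect_empty_eq)
qed

section \<open>Intensities of sets of marked points\<close>

locale mark_law = mark: prob_space mu for mu :: "real measure" +
  assumes sets_mu [measurable_cong]: "sets mu = sets borel"
begin

lemma marked_intensity_UNIV: "marked_intensity (UNIV :: (real^'d) set) mu = lborel \<Otimes>\<^sub>M mu"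
proof -
  have "(indicator UNIV :: real^'d \<Rightarrow> ennreal) = (\<lambda>_. 1)" by auto
  then show ?thesis by (simp add: marked_intensity_def density_1)
qed

lemma sets_marked_intensity: "sets (marked_intensity (W :: (real^'d) set) mu) = sets borel"
proof -
  have "sets (marked_intensity W mu) = sets ((borel :: (real^'d) measure) \<Otimes>\<^sub>M (borel :: real measure))"
    unfolding marked_intensity_def by (intro sets_pair_measure_cong) (auto simp: sets_mu)
  then show ?thesis by (simp only: borel_prod)
qed

lemma space_marked_intensity: "space (marked_intensity (W :: (real^'d) set) mu) = UNIV"
  using sets_eq_imp_space_eq[OF sets_marked_intensity, of W] by simp

sublocale pair: pair_sigma_finite "lborel :: (real^'d) measure" mu ..

lemma far_points_sets: "far_points T \<in> sets (borel :: ((real^'d) \<times> real) measure)"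
proof -
  have "far_points T = {p. T < norm (fst p :: real^'d)} \<inter> {p. norm (fst p) \<le> snd p}"
    by (auto simp: far_points_def)
  also have "\<dots> \<in> sets borel"
    by (intro sets.Int borel_open borel_closed open_Collect_less closed_Collect_le continuous_intros)
  finally show ?thesis .
qed

text \<open>For a fixed mark \<open>r\<close> the slice is a shell, whose volume is an integral over
  radii \<open>u\<close> from \<open>T\<close> to \<open>r\<close>. Exchanging the integrals turns
  the condition \<open>u \<le> r\<close> into the tail \<open>mu {u..}\<close>.\<close>

lemma emeasure_far_points:
  assumes "0 \<le> T"
  shows "emeasure (marked_intensity UNIV mu) (far_points T :: ((real^'d) \<times> real) set) =
    (\<integral>\<^sup>+u. ennreal (measure lborel (cball (0::real^'d) 1) * (real CARD('d) * u ^ (CARD('d) - 1))) *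
      emeasure mu {u..} * indicator {T..} u \<partial>lborel)"
    (is "_ = (\<integral>\<^sup>+u. ennreal (?g u) * _ * _ \<partial>lborel)")
proof -
  interpret L: pair_sigma_finite "lborel :: real measure" mu ..
  have "far_points T \<in> sets ((lborel :: (real^'d) measure) \<Otimes>\<^sub>M mu)"
    unfolding sets_marked_intensity[of UNIV, unfolded marked_intensity_UNIV] by (rule far_points_sets)
  then have "emeasure (marked_intensity UNIV mu) (far_points T :: ((real^'d) \<times> real) set) =
      (\<integral>\<^sup>+r. emeasure lborel ((\<lambda>x. (x, r)) -` (far_points T :: ((real^'d) \<times> real) set)) \<partial>mu)"
    unfolding marked_intensity_UNIV by (rule pair.emeasure_pair_measure_alt2)
  also have "\<dots> = (\<integral>\<^sup>+r. (\<integral>\<^sup>+u. ennreal (?g u) * indicator {T..r} u \<partial>lborel) \<partial>mu)"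
    using emeasure_lborel_shell[OF assms, where 'd='d]
    by (intro nn_integral_cong) (simp add: far_points_def vimage_def)
  also have "\<dots> = (\<integral>\<^sup>+u. (\<integral>\<^sup>+r. ennreal (?g u) * indicator {T..r} u \<partial>mu) \<partial>lborel)"
  proof (rule L.Fubini')
    \<comment> \<open>The interval with the moving endpoint \<open>r\<close> is rewritten as a
      subset of the product, which makes joint measurability evident.\<close>
    have "(\<lambda>p. ennreal (?g (fst p)) * indicator {p \<in> space (lborel \<Otimes>\<^sub>M mu). T \<le> fst p \<and> fst p \<le> snd p} p)
      \<in> borel_measurable (lborel \<Otimes>\<^sub>M mu)"
      by measurable
    also have "(\<lambda>p. ennreal (?g (fst p)) * indicator {p \<in> space (lborel \<Otimes>\<^sub>M mu). T \<le> fst p \<and> fst p \<le> snd p} p) =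
       (\<lambda>(u, r). ennreal (?g u) * indicator {T..r} u)"
      using sets_eq_imp_space_eq[OF sets_mu] by (auto simp: fun_eq_iff indicator_def space_pair_measure)
    finally show "(\<lambda>(u, r). ennreal (?g u) * indicator {T..r} u) \<in> borel_measurable (lborel \<Otimes>\<^sub>M mu)" .
  qed
  also have "\<dots> = (\<integral>\<^sup>+u. ennreal (?g u) * emeasure mu {u..} * indicator {T..} u \<partial>lborel)"
  proof (intro nn_integral_cong)
    fix u
    have "(\<integral>\<^sup>+r. ennreal (?g u) * indicator {T..r} u \<partial>mu) = (\<integral>\<^sup>+r. ennreal (?g u) * indicator {T..} u * indicator {u..} r \<partial>mu)"
      by (intro nn_integral_cong) (auto simp: indicator_def)
    also have "\<dots> = ennreal (?g u) * indicator {T..} u * emeasure mu {u..}"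
      by (subst nn_integral_cmult_indicator) (auto simp: sets_mu)
    finally show "(\<integral>\<^sup>+r. ennreal (?g u) * indicator {T..r} u \<partial>mu) = ennreal (?g u) * emeasure mu {u..} * indicator {T..} u"
      by (simp add: mult_ac)
  qed
  finally show ?thesis .
qed

text \<open>Integrates the volume \<kappa> r^d of the slice over the mark law. Marks must be
  nonnegative almost surely because the ball of negative radius is empty while r^d need not be 0. If
  the moment is infinite, both sides are 0 by convention.\<close>

lemma measure_covering_points:
  assumes "emeasure mu {..<0} = 0"
  shows "measure (marked_intensity UNIV mu) (covering_points :: ((real^'d) \<times> real) set) =
    measure lborel (cball (0::real^'d) 1) * (\<integral>r. r ^ CARD('d) \<partial>mu)"
    (is "measure _ ?A = ?k * _")
proof -
  have nonneg: "AE r in mu. 0 \<le> r"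
    using assms by (intro AE_I[of _ _ "{..<0}"]) (auto simp: sets_mu)
  have "?A \<in> sets ((lborel :: (real^'d) measure) \<Otimes>\<^sub>M mu)"
    unfolding sets_marked_intensity[of UNIV, unfolded marked_intensity_UNIV] by (rule covering_points_sets)
  then have "emeasure (marked_intensity UNIV mu) ?A =
      (\<integral>\<^sup>+r. emeasure lborel ((\<lambda>x. (x, r)) -` ?A) \<partial>mu)"
    unfolding marked_intensity_UNIV by (rule pair.emeasure_pair_measure_alt2)
  also have "\<dots> = (\<integral>\<^sup>+r. ennreal (?k * r ^ CARD('d)) \<partial>mu)"
  proof (rule nn_integral_cong_AE, use nonneg in eventually_elim)
    fix r :: real assume "0 \<le> r"
    moreover have "(\<lambda>x. (x, r)) -` ?A = cball 0 r" by (auto simp: covering_points_def)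
    ultimately show "emeasure lborel ((\<lambda>x. (x, r)) -` ?A) = ennreal (?k * r ^ CARD('d))"
      by (simp add: emeasure_lborel_cball_0)
  qed
  finally have "measure (marked_intensity UNIV mu) ?A = enn2real (\<integral>\<^sup>+r. ennreal (?k * r ^ CARD('d)) \<partial>mu)"
    by (simp add: measure_def)
  also have "\<dots> = (\<integral>r. ?k * r ^ CARD('d) \<partial>mu)"
    using nonneg by (intro integral_eq_nn_integral[symmetric]) (auto elim!: eventually_mono)
  finally show ?thesis by simp
qed

end

section \<open>Radial integrals of powers and of the mark tail\<close>

lemma filterlim_powr_neg_at_top:
  fixes a :: real assumes "a > 0" shows "((\<lambda>x. x powr (- a)) \<longlongrightarrow> 0) at_top"
  by (rule tendsto_neg_powr[OF _ filterlim_ident]) (use assms in auto)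

lemma nn_integral_powr_atLeast:
  fixes T c q :: real
  assumes "0 < T" "0 \<le> c" "0 < q"
  shows "(\<integral>\<^sup>+u. ennreal (c * u powr (- q - 1)) * indicator {T..} u \<partial>lborel) = ennreal (c * T powr (- q) / q)"
proof -
  have "(\<integral>\<^sup>+u. ennreal (c * u powr (- q - 1)) * indicator {T..} u \<partial>lborel) = ennreal (0 - (- c / q * T powr (- q)))"
  proof (rule nn_integral_FTC_atLeast)
    show "((\<lambda>u. - c / q * u powr (- q)) has_real_derivative c * u powr (- q - 1)) (at u)" if "T \<le> u" for u
      using that assms by (auto intro!: derivative_eq_intros)
    show "((\<lambda>u. - c / q * u powr (- q)) \<longlongrightarrow> 0) at_top"
      by (intro tendsto_mult_right_zero filterlim_powr_neg_at_top assms)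
  qed (use assms in auto)
  then show ?thesis by simp
qed

lemma nn_integral_inverse_atLeast:
  fixes T c :: real
  assumes "0 < T" "0 < c"
  shows "(\<integral>\<^sup>+u. ennreal (c / u) * indicator {T..} u \<partial>lborel) = \<infinity>"
proof -
  have le: "ennreal x \<le> (\<integral>\<^sup>+u. ennreal (c / u) * indicator {T..} u \<partial>lborel)" if "0 \<le> x" for x
  proof -
    \<comment> \<open>The upper limit \<open>T * exp (x / c)\<close> is chosen so that the integral
      of \<open>c / u\<close> up to it is exactly \<open>x\<close>.\<close>
    have T_le: "T \<le> T * exp (x / c)" using assms that by simp
    have "ennreal x = ennreal (c * ln (T * exp (x / c)) - c * ln T)"
      using assms by (simp add: ln_mult algebra_simps)
    also have "\<dots> = (\<integral>\<^sup>+u. ennreal (c / u) * indicator {T..T * exp (x / c)} u \<partial>lborel)"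
      using assms T_le
      by (intro nn_integral_FTC_Icc[symmetric]) (auto intro!: derivative_eq_intros)
    also have "\<dots> \<le> (\<integral>\<^sup>+u. ennreal (c / u) * indicator {T..} u \<partial>lborel)"
      by (intro nn_integral_mono) (auto simp: indicator_def)
    finally show ?thesis .
  qed
  show ?thesis
  proof (cases "\<integral>\<^sup>+u. ennreal (c / u) * indicator {T..} u \<partial>lborel")
    case (real r)
    with le[of "r + 1"] show ?thesis by (simp del: ennreal_plus)
  qed auto
qed

locale heavy_mark_law = mark_law +
  fixes \<beta> s :: real
  assumes beta_pos: "0 < \<beta>"
    and ac: "absolutely_continuous lborel mu"
    and tail: "((\<lambda>h. h powr s * measure mu {h<..}) \<longlongrightarrow> \<beta>) at_top"
begin

text \<open>Absolute continuity excludes atoms. This links the tail assumption, on marks above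
  \<open>h\<close>, to the intensity formula, on marks at least \<open>u\<close>.\<close>

lemma measure_atLeast: "measure mu {h..} = measure mu {h<..}"
proof -
  have "{h} \<in> null_sets lborel"
    by (rule finite_imp_null_set_lborel) simp
  with ac have "{h} \<in> null_sets mu"
    by (auto simp: absolutely_continuous_def)
  then have "measure mu ({h<..} \<union> {h}) = measure mu {h<..}"
    by (intro measure_Un_null_set) (auto simp: sets_mu)
  then show ?thesis
    by (simp only: Un_commute[of "{h<..}"] ivl_disj_un_singleton(1))
qed

lemma tail_atLeast: "((\<lambda>h. h powr s * measure mu {h..}) \<longlongrightarrow> \<beta>) at_top"
  using tail by (simp add: measure_atLeast)

context
  fixes d :: nat and k :: real
  assumes d: "0 < d" and k: "0 < k"
begin

lemma density_eq:
  assumes "0 < u"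
  shows "k * (real d * u ^ (d - 1)) = k * real d * u powr (real d - 1)"
  using assms d by (simp add: powr_realpow[symmetric] of_nat_diff)

text \<open>For large u the tail is at least (\<beta>/2) u^(-s), so for s \<le> d and u \<ge> 1 the
  integrand dominates a positive multiple of 1/u.\<close>

lemma radial_integral_infinite:
  assumes "s \<le> real d"
  obtains T where "1 \<le> T"
    "(\<integral>\<^sup>+u. ennreal (k * (real d * u ^ (d - 1))) * emeasure mu {u..} * indicator {T..} u \<partial>lborel) = \<infinity>"
proof -
  have "\<forall>\<^sub>F h in at_top. \<beta> / 2 < h powr s * measure mu {h..}"
    using beta_pos by (intro order_tendstoD(1)[OF tail_atLeast]) auto
  then obtain T0 where T0: "\<And>h. T0 \<le> h \<Longrightarrow> \<beta> / 2 < h powr s * measure mu {h..}"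
    by (auto simp: eventually_at_top_linorder)
  \<comment> \<open>The bound 1 gives \<open>u powr (s - 1) \<le> u powr (real d - 1)\<close> beyond
    \<open>T\<close>, and later makes the weights at least 1.\<close>
  define T where "T = max 1 T0"
  have "\<infinity> = (\<integral>\<^sup>+u. ennreal (k * real d * (\<beta> / 2) / u) * indicator {T..} u \<partial>lborel)"
    using beta_pos d k by (intro nn_integral_inverse_atLeast[symmetric]) (auto simp: T_def)
  also have "\<dots> \<le> (\<integral>\<^sup>+u. ennreal (k * (real d * u ^ (d - 1))) * emeasure mu {u..} * indicator {T..} u \<partial>lborel)"
  proof (intro nn_integral_mono)
    fix u
    show "ennreal (k * real d * (\<beta> / 2) / u) * indicator {T..} u
      \<le> ennreal (k * (real d * u ^ (d - 1))) * emeasure mu {u..} * indicator {T..} u"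
    proof (cases "T \<le> u")
      case True
      then have u: "1 \<le> u" "\<beta> / 2 < u powr s * measure mu {u..}"
        using T0 by (auto simp: T_def)
      have "\<beta> / 2 / u \<le> u powr s * measure mu {u..} / u"
        using u by (intro divide_right_mono) auto
      also have "\<dots> = u powr (s - 1) * measure mu {u..}"
        using u by (simp add: powr_diff)
      also have "\<dots> \<le> u powr (real d - 1) * measure mu {u..}"
        using u assms by (intro mult_right_mono powr_mono) auto
      finally have "k * real d * (\<beta> / 2 / u) \<le> k * real d * (u powr (real d - 1) * measure mu {u..})"
        using k by (intro mult_left_mono) auto
      then have "ennreal (k * real d * (\<beta> / 2) / u) \<le> ennreal (k * (real d * u ^ (d - 1)) * measure mu {u..})"
        using u by (intro ennreal_leI) (subst density_eq; simp add: mult_ac)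
      with True show ?thesis
        using u k by (simp add: mark.emeasure_eq_measure ennreal_mult'')
    qed simp
  qed
  finally show ?thesis
    using that[of T] by (simp add: T_def top_unique)
qed

text \<open>Beyond a large T the tail lies between c u^(-s) and c' u^(-s) for any nonnegative c <
  \<beta> and any c' > \<beta>. A pure power integrates to k d c T^(-q) / q with q = s - d, and c,
  c' may be taken arbitrarily close to \<beta>.\<close>

lemma radial_integral_asymp:
  assumes "real d < s"
  defines "I \<equiv> \<lambda>T. \<integral>\<^sup>+u. ennreal (k * (real d * u ^ (d - 1))) * emeasure mu {u..} * indicator {T..} u \<partial>lborel"
  shows "\<forall>\<^sub>F T in at_top. I T < \<infinity>"
    and "((\<lambda>T. T powr (s - real d) * enn2real (I T)) \<longlongrightarrow> k * real d * \<beta> / (s - real d)) at_top"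
proof -
  define q where "q = s - real d"
  have q: "0 < q" using assms by (simp add: q_def)
  have dens: "k * real d * c * u powr (- q - 1) = k * (real d * u ^ (d - 1)) * (c * u powr (- s))" if "0 < u" for c u
    unfolding density_eq[OF that] using that by (simp add: q_def powr_add[symmetric] algebra_simps)
  have upper: "I T \<le> ennreal (k * real d * c * T powr (- q) / q)"
    if "0 < T" "0 \<le> c" "\<And>u. T \<le> u \<Longrightarrow> u powr s * measure mu {u..} \<le> c" for T c
  proof -
    have "I T \<le> (\<integral>\<^sup>+u. ennreal (k * real d * c * u powr (- q - 1)) * indicator {T..} u \<partial>lborel)"
      unfolding I_def
    proof (intro nn_integral_mono)
      fix u
      show "ennreal (k * (real d * u ^ (d - 1))) * emeasure mu {u..} * indicator {T..} u
          \<le> ennreal (k * real d * c * u powr (- q - 1)) * indicator {T..} u"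
      proof (cases "T \<le> u")
        case True
        then have u: "0 < u" "measure mu {u..} \<le> c * u powr (- s)"
          using that(1) that(3)[of u] by (auto simp: powr_minus field_simps)
        then have "k * (real d * u ^ (d - 1)) * measure mu {u..} \<le> k * (real d * u ^ (d - 1)) * (c * u powr (- s))"
          using k by (intro mult_left_mono) auto
        then show ?thesis
          using True u k by (subst dens) (auto simp: mark.emeasure_eq_measure ennreal_mult''[symmetric] intro!: ennreal_leI)
      qed simp
    qed
    also have "\<dots> = ennreal (k * real d * c * T powr (- q) / q)"
      using that k q by (intro nn_integral_powr_atLeast) auto
    finally show ?thesis .
  qed
  have lower: "ennreal (k * real d * c * T powr (- q) / q) \<le> I T"
    if "0 < T" "0 \<le> c" "\<And>u. T \<le> u \<Longrightarrow> c \<le> u powr s * measure mu {u..}" for T c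
  proof -
    have "ennreal (k * real d * c * T powr (- q) / q) = (\<integral>\<^sup>+u. ennreal (k * real d * c * u powr (- q - 1)) * indicator {T..} u \<partial>lborel)"
      using that k q by (intro nn_integral_powr_atLeast[symmetric]) auto
    also have "\<dots> \<le> I T"
      unfolding I_def
    proof (intro nn_integral_mono)
      fix u
      show "ennreal (k * real d * c * u powr (- q - 1)) * indicator {T..} u
        \<le> ennreal (k * (real d * u ^ (d - 1))) * emeasure mu {u..} * indicator {T..} u"
      proof (cases "T \<le> u")
        case True
        then have u: "0 < u" "c * u powr (- s) \<le> measure mu {u..}"
          using that(1) that(3)[of u] by (auto simp: powr_minus field_simps)
        then have "k * (real d * u ^ (d - 1)) * (c * u powr (- s)) \<le> k * (real d * u ^ (d - 1)) * measure mu {u..}"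
          using k by (intro mult_left_mono) auto
        then show ?thesis
          using True u k by (subst dens) (auto simp: mark.emeasure_eq_measure ennreal_mult''[symmetric] intro!: ennreal_leI)
      qed simp
    qed
    finally show ?thesis .
  qed
  have ev_ub: "\<forall>\<^sub>F T in at_top. I T \<le> ennreal (k * real d * c * T powr (- q) / q)" if "\<beta> < c" for c
  proof -
    obtain T0 where T0: "\<And>h. T0 \<le> h \<Longrightarrow> h powr s * measure mu {h..} < c"
      using order_tendstoD(2)[OF tail_atLeast \<open>\<beta> < c\<close>] by (auto simp: eventually_at_top_linorder)
    then show ?thesis
      using beta_pos that T0 by (intro eventually_at_top_linorderI[of "max 1 T0"] upper) (auto intro: less_imp_le)
  qed
  have ev_lb: "\<forall>\<^sub>F T in at_top. ennreal (k * real d * c * T powr (- q) / q) \<le> I T" if "c < \<beta>" "0 \<le> c" for c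
  proof -
    obtain T0 where T0: "\<And>h. T0 \<le> h \<Longrightarrow> c < h powr s * measure mu {h..}"
      using order_tendstoD(1)[OF tail_atLeast \<open>c < \<beta>\<close>] by (auto simp: eventually_at_top_linorder)
    then show ?thesis
      using that T0 by (intro eventually_at_top_linorderI[of "max 1 T0"] lower) (auto intro: less_imp_le)
  qed
  show fin: "\<forall>\<^sub>F T in at_top. I T < \<infinity>"
    using ev_ub[of "\<beta> + 1"] by (auto elim!: eventually_mono intro: le_less_trans)
  have scale: "k * real d * c / q = T powr q * (k * real d * c * T powr (- q) / q)" if "0 < T" for c T
    using that by (simp add: powr_minus field_simps)
  have "((\<lambda>T. T powr q * enn2real (I T)) \<longlongrightarrow> k * real d * \<beta> / q) at_top"
  proof (rule order_tendstoI)
    fix a assume a: "k * real d * \<beta> / q < a"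
    \<comment> \<open>The midpoint between \<beta> and the value of \<open>c\<close> at which
      \<open>k * real d * c / q\<close> equals \<open>a\<close>.\<close>
    define c where "c = (\<beta> + a * q / (k * real d)) / 2"
    have "\<beta> < c" "k * real d * c / q < a"
      using a k d q by (auto simp: c_def field_simps)
    from ev_ub[OF this(1)] eventually_gt_at_top[of 0]
    show "\<forall>\<^sub>F T in at_top. T powr q * enn2real (I T) < a"
    proof eventually_elim
      case (elim T)
      have "0 \<le> c" using \<open>\<beta> < c\<close> beta_pos by simp
      then have "enn2real (I T) \<le> k * real d * c * T powr (- q) / q"
        using elim(1) k q by (intro enn2real_leI) auto
      then have "T powr q * enn2real (I T) \<le> k * real d * c / q"
        unfolding scale[OF elim(2)] by (intro mult_left_mono) auto
      also have "\<dots> < a" by fact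
      finally show ?case .
    qed
  next
    fix a assume a: "a < k * real d * \<beta> / q"
    \<comment> \<open>The same midpoint, cut off at 0 because \<open>lower\<close> needs a
      nonnegative constant; if the cut applies, then \<open>a\<close> is negative.\<close>
    define c where "c = max 0 ((\<beta> + a * q / (k * real d)) / 2)"
    have c: "c < \<beta>" "0 \<le> c" and ac: "a < k * real d * c / q \<or> a < 0 \<or> a = 0 \<and> c > 0"
      using a k d q beta_pos by (auto simp: c_def field_simps max_def)
    have ac': "a < k * real d * c / q"
      using ac c k d q 
      by (smt (verit) divide_nonneg_pos divide_pos_pos mult_nonneg_nonneg mult_pos_pos of_nat_0_less_iff)
    \<comment> \<open>Finiteness enters because \<open>enn2real\<close> sends infinity to 0 and is
      monotone only below it.\<close>
    from ev_lb[OF c] fin eventually_gt_at_top[of 0]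
    show "\<forall>\<^sub>F T in at_top. a < T powr q * enn2real (I T)"
    proof eventually_elim
      case (elim T)
      have "k * real d * c * T powr (- q) / q \<le> enn2real (I T)"
        using elim(1,2) k q c by (metis enn2real_ennreal enn2real_mono divide_nonneg_pos infinity_ennreal_def
            mult_nonneg_nonneg of_nat_0_le_iff order_less_imp_le powr_ge_zero)
      then have "k * real d * c / q \<le> T powr q * enn2real (I T)"
        unfolding scale[OF elim(3)] by (intro mult_left_mono) auto
      with ac' show ?case by simp
    qed
  qed
  then show "((\<lambda>T. T powr (s - real d) * enn2real (I T)) \<longlongrightarrow> k * real d * \<beta> / (s - real d)) at_top"
    by (simp add: q_def)
qed

end

end

subsection \<open>Tails of sums over a Poisson process\<close>

context poisson_process
begin

context
  fixes f :: "'p \<Rightarrow> ennreal" and B :: "'p set"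
  assumes f [measurable]: "f \<in> borel_measurable N"
    and B: "B \<in> sets N" "emeasure N B < \<infinity>" and f_zero: "\<And>p. p \<notin> B \<Longrightarrow> f p = 0"
begin

lemma points_sum_measurable: "(\<lambda>\<omega>. \<integral>\<^sup>+p. f p \<partial>count_space (X \<omega>)) \<in> borel_measurable M"
proof -
  have "f p * indicator (space N) p = f p" for p
    using f_zero[of p] sets.sets_into_space[OF B(1)] by (cases "p \<in> B") auto
  then show ?thesis
    using nn_integral_points_measurable[OF f] by simp
qed

lemma superlevel_sets:
  "{p. t < f p} \<in> sets N" "emeasure N {p. t < f p} < \<infinity>"
proof -
  have "{p. t < f p} \<subseteq> B" using f_zero by fastforce
  then have "{p. t < f p} = {p \<in> space N. t < f p}"
    using sets.sets_into_space[OF B(1)] by auto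
  then show "{p. t < f p} \<in> sets N" by simp
  have "emeasure N {p. t < f p} \<le> emeasure N B"
    using B \<open>_ \<subseteq> B\<close> by (intro emeasure_mono)
  then show "emeasure N {p. t < f p} < \<infinity>" using B(2) by (rule le_less_trans)
qed

text \<open>A single point of weight above \<open>t\<close> already carries the sum beyond
  \<open>t\<close>.\<close>

lemma prob_sum_gt_ge:
  "1 - exp (- measure N {p. t < f p}) \<le> prob {\<omega> \<in> space M. t < (\<integral>\<^sup>+p. f p \<partial>count_space (X \<omega>))}"
proof -
  note [measurable] = points_sum_measurable
  have "t < (\<integral>\<^sup>+p. f p \<partial>count_space P)" if "1 \<le> npts P {p. t < f p}" for P
  proof -
    have "P \<inter> {p. t < f p} \<noteq> {}"
      using that by (auto simp: npts_def one_enat_def zero_enat_def)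
    then obtain p where "p \<in> P" "t < f p" by blast
    with nn_integral_ge_point[of p P f] show ?thesis by (auto intro: less_le_trans)
  qed
  then have "prob {\<omega> \<in> space M. 1 \<le> npts (X \<omega>) {p. t < f p}} \<le> prob {\<omega> \<in> space M. t < (\<integral>\<^sup>+p. f p \<partial>count_space (X \<omega>))}"
    by (intro finite_measure_mono) auto
  then show ?thesis
    by (simp add: prob_npts_ge_1[OF superlevel_sets])
qed

text \<open>Union bound over three bad events: a term above \<open>b\<close>, two terms above
  \<open>a\<close>, more than \<open>K\<close> points in \<open>B\<close>. Off these, one term is at
  most \<open>b\<close> and the others add at most \<open>K * a\<close>.\<close>

lemma prob_sum_gt_le:
  fixes a b t :: real
  assumes "0 \<le> a" "0 \<le> b" "b + real K * a \<le> t"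
  shows "prob {\<omega> \<in> space M. ennreal t < (\<integral>\<^sup>+p. f p \<partial>count_space (X \<omega>))} \<le>
    measure N {p. ennreal b < f p} + (measure N {p. ennreal a < f p})\<^sup>2 + exp ((exp 1 - 1) * measure N B - real K)"
proof -
  note [measurable] = points_sum_measurable
  let ?E1 = "{\<omega> \<in> space M. 1 \<le> npts (X \<omega>) {p. ennreal b < f p}}"
  let ?E2 = "{\<omega> \<in> space M. 2 \<le> npts (X \<omega>) {p. ennreal a < f p}}"
  let ?E3 = "{\<omega> \<in> space M. enat K < npts (X \<omega>) B}"
  have E: "?E1 \<in> events" "?E2 \<in> events" "?E3 \<in> events"
    using npts_measurable[OF superlevel_sets(1)] npts_measurable[OF B(1)] by measurable
  have "(\<integral>\<^sup>+p. f p \<partial>count_space P) \<le> ennreal t"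
    if "\<not> 1 \<le> npts P {p. ennreal b < f p}" "\<not> 2 \<le> npts P {p. ennreal a < f p}" "\<not> enat K < npts P B" for P
  proof -
    have "P \<inter> {p. ennreal b < f p} = {}"
      using that(1) by (auto simp: npts_def one_enat_def card_gt_0_iff Suc_le_eq split: if_splits)
    then have fb: "f p \<le> ennreal b" if "p \<in> P" for p using that by (auto simp: not_less)
    \<comment> \<open>Every point of \<open>B\<close> is charged \<open>a\<close>, and a point of
      weight above \<open>a\<close> is charged \<open>b\<close> in addition, so only two counts
      remain.\<close>
    have "(\<integral>\<^sup>+p. f p \<partial>count_space P) \<le>
      (\<integral>\<^sup>+p. ennreal a * indicator B p + ennreal b * indicator {p. ennreal a < f p} p \<partial>count_space P)"
      using fb f_zero by (intro nn_integral_mono) (auto simp: indicator_def intro: add_increasing)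
    also have "\<dots> = ennreal a * ennreal_of_enat (npts P B) + ennreal b * ennreal_of_enat (npts P {p. ennreal a < f p})"
      by (simp add: nn_integral_add nn_integral_cmult nn_integral_count_space_indicator_npts del: nn_integral_indicator)
    also have "\<dots> \<le> ennreal a * ennreal_of_enat (enat K) + ennreal b * ennreal_of_enat 1"
    proof (intro add_mono mult_left_mono)
      show "ennreal_of_enat (npts P B) \<le> ennreal_of_enat (enat K)"
        using that(3) by (simp only: ennreal_of_enat_le_iff not_less)
      have "npts P {p. ennreal a < f p} \<le> 1"
        using that(2) by (cases "npts P {p. ennreal a < f p}") (auto simp: numeral_eq_enat one_enat_def)
      then show "ennreal_of_enat (npts P {p. ennreal a < f p}) \<le> ennreal_of_enat 1"
        by (simp only: ennreal_of_enat_le_iff)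
    qed auto
    also have "\<dots> = ennreal (b + real K * a)"
      using assms by (simp add: ennreal_plus ennreal_mult ennreal_of_nat_eq_real_of_nat mult_ac add_ac)
    also have "\<dots> \<le> ennreal t" using assms by (intro ennreal_leI)
    finally show ?thesis .
  qed
  then have "{\<omega> \<in> space M. ennreal t < (\<integral>\<^sup>+p. f p \<partial>count_space (X \<omega>))} \<subseteq> ?E1 \<union> ?E2 \<union> ?E3"
    by (auto simp: not_less[symmetric])
  then have "prob {\<omega> \<in> space M. ennreal t < (\<integral>\<^sup>+p. f p \<partial>count_space (X \<omega>))} \<le> prob (?E1 \<union> ?E2 \<union> ?E3)"
    by (rule finite_measure_mono) (intro sets.Un E)
  also have "\<dots> \<le> prob ?E1 + prob ?E2 + prob ?E3"
    using E by (intro order_trans[OF measure_Un_le] add_mono) auto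
  also have "\<dots> \<le> measure N {p. ennreal b < f p} + (measure N {p. ennreal a < f p})\<^sup>2 + exp ((exp 1 - 1) * measure N B - real K)"
  proof (intro add_mono prob_npts_ge_2_le prob_npts_gt_le superlevel_sets B)
    show "prob ?E1 \<le> measure N {p. ennreal b < f p}"
      using exp_ge_add_one_self[of "- measure N {p. ennreal b < f p}"]
      by (simp add: prob_npts_ge_1[OF superlevel_sets])
  qed
  finally show ?thesis .
qed

text \<open>Squeezes the tail of the sum between that of its largest term, from
  \<open>prob_sum_gt_ge\<close>, and the bound of \<open>prob_sum_gt_le\<close> with thresholds
  depending on \<open>t\<close>.\<close>

lemma prob_sum_gt_asymp:
  assumes "0 < \<gamma>" and lim: "((\<lambda>t. t powr \<gamma> * measure N {p. ennreal t < f p}) \<longlongrightarrow> c) at_top"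
  shows "((\<lambda>t. t powr \<gamma> * prob {\<omega> \<in> space M. ennreal t < (\<integral>\<^sup>+p. f p \<partial>count_space (X \<omega>))}) \<longlongrightarrow> c) at_top"
proof -
  define G where "G t = measure N {p. ennreal t < f p}" for t
  have limG: "((\<lambda>t. t powr \<gamma> * G t) \<longlongrightarrow> c) at_top" using lim by (simp add: G_def)
  have Gnn: "0 \<le> G t" for t by (simp add: G_def)
  define m where "m = (exp 1 - 1) * measure N B"
  let ?p = "\<lambda>t. prob {\<omega> \<in> space M. ennreal t < (\<integral>\<^sup>+p. f p \<partial>count_space (X \<omega>))}"
  \<comment> \<open>The level \<open>b t\<close> is asymptotic to \<open>t\<close>. The exponent 3/4
    exceeds 1/2, so the square of \<open>G (a t)\<close> is of smaller order than
    \<open>t powr (- \<gamma>)\<close>, and it leaves room for about \<open>t powr (1/8)\<close>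
    terms of size \<open>a t\<close> within \<open>t powr (7/8)\<close>.\<close>
  define a b :: "real \<Rightarrow> real" where "a t = t powr (3/4)" and "b t = t - t powr (7/8)" for t
  have G0: "(G \<longlongrightarrow> 0) at_top"
  proof -
    have "((\<lambda>t. t powr (- \<gamma>) * (t powr \<gamma> * G t)) \<longlongrightarrow> 0 * c) at_top"
      by (intro tendsto_mult limG filterlim_powr_neg_at_top assms)
    moreover have "\<forall>\<^sub>F t in at_top. t powr (- \<gamma>) * (t powr \<gamma> * G t) = G t"
      using eventually_gt_at_top[of 0] by eventually_elim (simp add: powr_minus)
    ultimately show ?thesis by (simp add: tendsto_cong)
  qed
  \<comment> \<open>Comes from 1 - e^(-G) \<ge> G / (1 + G), which is sharp as G tends to 0.\<close>
  have lower: "((\<lambda>t. t powr \<gamma> * G t / (1 + G t)) \<longlongrightarrow> c / (1 + 0)) at_top"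
    by (intro tendsto_intros limG G0) auto
  have upper1: "((\<lambda>t. (t / b t) powr \<gamma> * (b t powr \<gamma> * G (b t))) \<longlongrightarrow> 1 powr \<gamma> * c) at_top"
  proof (intro tendsto_mult tendsto_powr tendsto_const)
    show "((\<lambda>t. t / b t) \<longlongrightarrow> 1) at_top" unfolding b_def by real_asymp
    have "filterlim b at_top at_top" unfolding b_def by real_asymp
    then show "((\<lambda>t. b t powr \<gamma> * G (b t)) \<longlongrightarrow> c) at_top"
      by (rule filterlim_compose[OF limG])
  qed simp
  \<comment> \<open>The remaining exponent is
    \<open>\<gamma> - 2 * (3/4) * \<gamma> = - (\<gamma> / 2)\<close>.\<close>
  have upper2: "((\<lambda>t. t powr (- (\<gamma> / 2)) * (a t powr \<gamma> * G (a t))\<^sup>2) \<longlongrightarrow> 0 * c\<^sup>2) at_top"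
  proof (intro tendsto_mult tendsto_power filterlim_powr_neg_at_top)
    have "filterlim a at_top at_top" unfolding a_def by real_asymp
    then show "((\<lambda>t. a t powr \<gamma> * G (a t)) \<longlongrightarrow> c) at_top"
      by (rule filterlim_compose[OF limG])
  qed (use assms in simp)
  have upper3: "((\<lambda>t. t powr \<gamma> * exp (m + 1 - t powr (1/8))) \<longlongrightarrow> 0) at_top"
    using assms by real_asymp
  have upper: "((\<lambda>t. (t / b t) powr \<gamma> * (b t powr \<gamma> * G (b t)) + t powr (- (\<gamma> / 2)) * (a t powr \<gamma> * G (a t))\<^sup>2
      + t powr \<gamma> * exp (m + 1 - t powr (1/8))) \<longlongrightarrow> c) at_top"
    using tendsto_add[OF tendsto_add[OF upper1 upper2] upper3] by simp
  show ?thesis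
  proof (rule tendsto_sandwich[OF _ _ _ upper])
    show "((\<lambda>t. t powr \<gamma> * G t / (1 + G t)) \<longlongrightarrow> c) at_top" using lower by simp
    show "\<forall>\<^sub>F t in at_top. t powr \<gamma> * G t / (1 + G t) \<le> t powr \<gamma> * ?p t"
    proof (intro always_eventually allI)
      fix t
      have "G t / (1 + G t) = 1 - 1 / (1 + G t)"
        using Gnn[of t] by (simp add: field_simps)
      also have "\<dots> \<le> 1 - exp (- G t)"
        using Gnn[of t] exp_ge_add_one_self[of "G t"]
        by (intro diff_left_mono) (simp add: exp_minus inverse_eq_divide frac_le)
      also have "\<dots> \<le> ?p t" unfolding G_def by (rule prob_sum_gt_ge)
      finally have "t powr \<gamma> * (G t / (1 + G t)) \<le> t powr \<gamma> * ?p t"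
        by (intro mult_left_mono) auto
      then show "t powr \<gamma> * G t / (1 + G t) \<le> t powr \<gamma> * ?p t" by simp
    qed
    have bpos: "\<forall>\<^sub>F t in at_top. 0 < b t" unfolding b_def by real_asymp
    show "\<forall>\<^sub>F t in at_top. t powr \<gamma> * ?p t \<le> (t / b t) powr \<gamma> * (b t powr \<gamma> * G (b t))
        + t powr (- (\<gamma> / 2)) * (a t powr \<gamma> * G (a t))\<^sup>2 + t powr \<gamma> * exp (m + 1 - t powr (1/8))"
      using bpos eventually_gt_at_top[of 0]
    proof eventually_elim
      case (elim t)
      \<comment> \<open>Rounding down loses at most 1, which accounts for \<open>m + 1\<close> in
        the exponential term.\<close>
      define K where "K = nat \<lfloor>t powr (1/8)\<rfloor>"
      have K: "real K \<le> t powr (1/8)" "t powr (1/8) - 1 \<le> real K"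
        by (auto simp: K_def)
      have "real K * a t \<le> t powr (1/8) * a t"
        using K by (intro mult_right_mono) (auto simp: a_def)
      also have "\<dots> = t powr (7/8)" by (simp add: a_def powr_add[symmetric])
      finally have "b t + real K * a t \<le> t" by (simp add: b_def)
      then have "?p t \<le> G (b t) + (G (a t))\<^sup>2 + exp (m - real K)"
        using prob_sum_gt_le[of "a t" "b t" K t] elim by (simp add: G_def m_def a_def)
      also have "\<dots> \<le> G (b t) + (G (a t))\<^sup>2 + exp (m + 1 - t powr (1/8))"
        using K by simp
      finally have "t powr \<gamma> * ?p t \<le> t powr \<gamma> * (G (b t) + (G (a t))\<^sup>2 + exp (m + 1 - t powr (1/8)))"
        by (intro mult_left_mono) auto
      also have "\<dots> = t powr \<gamma> * G (b t) + t powr \<gamma> * (G (a t))\<^sup>2 + t powr \<gamma> * exp (m + 1 - t powr (1/8))"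
        by (simp add: algebra_simps)
      also have "t powr \<gamma> * G (b t) = (t / b t) powr \<gamma> * (b t powr \<gamma> * G (b t))"
        using elim by (simp add: powr_divide)
      also have "t powr \<gamma> * (G (a t))\<^sup>2 = t powr (- (\<gamma> / 2)) * (a t powr \<gamma> * G (a t))\<^sup>2"
        using elim by (simp add: a_def power_mult_distrib powr_powr powr_power powr_add[symmetric])
      finally show ?case .
    qed
  qed
qed

end

end

subsection \<open>The in-degree\<close>

lemma torus_box_sets: "(torus_box n :: (real^'d) set) \<in> sets borel"
proof -
  have "(torus_box n :: (real^'d) set) = (\<Inter>i\<in>UNIV. {x. - real n / 2 \<le> x $ i} \<inter> {x. x $ i < real n / 2})"
    by (auto simp: torus_box_def)
  also have "\<dots> \<in> sets borel"
    by (intro sets.finite_INT sets.Int borel_closed borel_open closed_Collect_le open_Collect_less continuous_intros) auto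
  finally show ?thesis .
qed

lemma emeasure_torus_box_finite: "emeasure lborel (torus_box n :: (real^'d) set) < \<infinity>"
proof -
  have "(torus_box n :: (real^'d) set) \<subseteq> cbox (\<chi> i. - real n / 2) (\<chi> i. real n / 2)"
    by (force simp: torus_box_def mem_box_cart intro: less_imp_le)
  then have "emeasure lborel (torus_box n :: (real^'d) set) \<le> emeasure lborel (cbox (\<chi> i. - real n / 2) (\<chi> i. real n / 2) :: (real^'d) set)"
    by (intro emeasure_mono) auto
  then show ?thesis
    using emeasure_lborel_cbox_finite by (rule le_less_trans)
qed

lemma torus_box_mono: "m \<le> n \<Longrightarrow> torus_box m \<subseteq> torus_box n"
  unfolding torus_box_def by (auto intro: order_trans[rotated] less_le_trans simp: divide_right_mono)

lemma torus_box_exhausts: "\<exists>n. (x :: real^'d) \<in> torus_box n"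
proof -
  obtain n where n: "2 * norm x < real n" using reals_Archimedean2 by blast
  have "\<bar>x $ i\<bar> \<le> norm x" for i by (rule component_le_norm_cart)
  with n have "x \<in> torus_box n"
    unfolding torus_box_def by (smt (verit) field_sum_of_halves mem_Collect_eq)
  then show ?thesis ..
qed

text \<open>Each coordinate has absolute value at most n/2, so the way around the torus is never
  shorter than the direct one.\<close>

lemma tor_dist_0:
  assumes "x \<in> torus_box n"
  shows "tor_dist n 0 x = norm x"
proof -
  have "min \<bar>x $ i\<bar> (real n - \<bar>x $ i\<bar>) = \<bar>x $ i\<bar>" for i
  proof -
    have "- real n / 2 \<le> x $ i" "x $ i < real n / 2" using assms by (auto simp: torus_box_def)
    then show ?thesis by linarith
  qed
  then show ?thesis by (simp add: tor_dist_def norm_vec_def L2_set_def)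
qed

section \<open>The weight of a marked point\<close>

definition in_weight :: "real \<Rightarrow> (real^'d) \<times> real \<Rightarrow> ennreal" where
  "in_weight \<alpha> p = ennreal (pw (norm (fst p)) \<alpha>) * indicator (cball 0 (snd p)) (fst p)"

lemma D_in_eq: "D_in \<alpha> P = (\<integral>\<^sup>+p. in_weight \<alpha> p \<partial>count_space P)"
  by (simp add: D_in_def in_weight_def)

lemma D_in_torus_eq:
  "D_in_torus n \<alpha> P = (\<integral>\<^sup>+p. in_weight \<alpha> p * indicator (torus_box n) (fst p) \<partial>count_space P)"
  unfolding D_in_torus_def
proof (intro nn_integral_cong)
  fix p :: "(real^'d) \<times> real"
  show "ennreal (pw (tor_dist n 0 (fst p)) \<alpha>) * indicator (tor_ball n 0 (snd p)) (fst p) =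
      in_weight \<alpha> p * indicator (torus_box n) (fst p)"
    by (cases "fst p \<in> torus_box n") (auto simp: in_weight_def tor_ball_def tor_dist_0 indicator_def)
qed

lemma in_weight_covering: "in_weight \<alpha> p = ennreal (pw (norm (fst p)) \<alpha>) * indicator covering_points p"
  by (simp add: in_weight_def covering_points_def indicator_def)

lemma in_weight_measurable: "in_weight \<alpha> \<in> borel_measurable (borel :: ((real^'d) \<times> real) measure)"
proof -
  have [measurable]: "covering_points \<in> sets (borel :: ((real^'d) \<times> real) measure)"
    by (rule covering_points_sets)
  have [measurable]: "(\<lambda>p. norm (fst p :: real^'d)) \<in> borel_measurable (borel :: ((real^'d) \<times> real) measure)"
    by (intro borel_measurable_continuous_onI continuous_intros)
  have "(\<lambda>p. pw (norm (fst p)) \<alpha>) \<in> borel_measurable (borel :: ((real^'d) \<times> real) measure)"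
    unfolding pw_def by measurable
  then show ?thesis unfolding in_weight_covering[abs_def] by measurable
qed

lemma in_weight_superlevel:
  assumes "0 < \<alpha>" "0 < t"
  shows "{p. ennreal t < in_weight \<alpha> p} = far_points (t powr (1 / \<alpha>))"
proof -
  have "t < x powr \<alpha> \<longleftrightarrow> t powr (1 / \<alpha>) < x" if "0 \<le> x" for x :: real
  proof -
    have "t powr (1 / \<alpha>) < x \<longleftrightarrow> (t powr (1 / \<alpha>)) powr \<alpha> < x powr \<alpha>"
      using assms that by (metis not_less powr_less_mono2 powr_ge_zero powr_mono2 less_imp_le)
    then show ?thesis using assms by (simp add: powr_powr)
  qed
  then show ?thesis
    using assms
    by (auto simp: in_weight_covering far_points_def covering_points_def pw_def indicator_def ennreal_less_iff
        split: if_splits)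
qed

section \<open>Convergence in distribution of the degree on the torus\<close>

context mark_law
begin

text \<open>Slices of \<open>A\<close> over points outside the box are empty, so the density factor
  changes nothing; the total is at most the volume of the box since the mark law has mass 1.\<close>

lemma emeasure_marked_intensity_torus_box:
  assumes A: "A \<in> sets (borel :: ((real^'d) \<times> real) measure)" and sub: "A \<subseteq> torus_box n \<times> UNIV"
  shows "emeasure (marked_intensity (torus_box n) mu) A = emeasure (marked_intensity UNIV mu) A"
    and "emeasure (marked_intensity (torus_box n) mu) A < \<infinity>"
proof -
  let ?W = "torus_box n :: (real^'d) set"
  have W [measurable]: "?W \<in> sets borel" by (rule torus_box_sets)
  have A': "A \<in> sets (lborel \<Otimes>\<^sub>M mu)" "A \<in> sets (density lborel (indicator ?W) \<Otimes>\<^sub>M mu)"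
    unfolding sets_marked_intensity[of UNIV, unfolded marked_intensity_UNIV]
      sets_marked_intensity[of ?W, unfolded marked_intensity_def] by fact+
  have slice: "(\<lambda>x. emeasure mu (Pair x -` A)) \<in> borel_measurable lborel"
    by (rule mark.measurable_emeasure_Pair) fact
  have box: "emeasure (marked_intensity ?W mu) A = (\<integral>\<^sup>+x. indicator ?W x * emeasure mu (Pair x -` A) \<partial>lborel)"
    unfolding marked_intensity_def mark.emeasure_pair_measure_alt[OF A'(2)]
    using slice by (subst nn_integral_density) auto
  also have "\<dots> = (\<integral>\<^sup>+x. emeasure mu (Pair x -` A) \<partial>lborel)"
  proof (intro nn_integral_cong)
    fix x
    have "Pair x -` A = {}" if "x \<notin> ?W" using sub that by auto
    then show "indicator ?W x * emeasure mu (Pair x -` A) = emeasure mu (Pair x -` A)"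
      by (cases "x \<in> ?W") auto
  qed
  also have "\<dots> = emeasure (marked_intensity UNIV mu) A"
    unfolding marked_intensity_UNIV by (rule mark.emeasure_pair_measure_alt[OF A'(1), symmetric])
  finally show "emeasure (marked_intensity ?W mu) A = emeasure (marked_intensity UNIV mu) A" .
  have "emeasure (marked_intensity ?W mu) A \<le> (\<integral>\<^sup>+x. indicator ?W x \<partial>lborel)"
    unfolding box by (intro nn_integral_mono) (auto simp: indicator_def mark.emeasure_eq_measure)
  also have "\<dots> < \<infinity>" using emeasure_torus_box_finite by simp
  finally show "emeasure (marked_intensity ?W mu) A < \<infinity>" .
qed

lemma D_in_measurable:
  assumes "marked_poisson_pp M X (UNIV :: (real^'d) set) mu"
  shows "(\<lambda>\<omega>. D_in \<alpha> (X \<omega>)) \<in> borel_measurable M"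
proof -
  interpret poisson_process M X "marked_intensity UNIV mu"
    by (rule poisson_process_marked) fact
  have "in_weight \<alpha> \<in> borel_measurable (marked_intensity (UNIV :: (real^'d) set) mu)"
    using in_weight_measurable by (simp add: measurable_cong_sets[OF sets_marked_intensity refl])
  from nn_integral_points_measurable[OF this] show ?thesis
    by (simp add: D_in_eq space_marked_intensity)
qed

text \<open>The spaces \<open>M n\<close> are unrelated to \<open>M0\<close>, so only laws can be
  compared: \<open>Xn n\<close> is replaced by the part of \<open>X\<close> in the box. The
  resulting sums increase to \<open>D_in\<close>, and continuity from above gives convergence at
  every threshold \<open>t\<close>.\<close>

lemma D_in_torus_conv:
  assumes Mn: "\<And>n. 1 \<le> n \<Longrightarrow> marked_poisson_pp (M n) (Xn n) (torus_box n :: (real^'d) set) mu"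
    and M0: "marked_poisson_pp M0 X (UNIV :: (real^'d) set) mu"
  shows "(\<lambda>n. measure (M n) {\<omega> \<in> space (M n). D_in_torus n \<alpha> (Xn n \<omega>) \<le> t})
    \<longlonglongrightarrow> measure M0 {\<omega> \<in> space M0. D_in \<alpha> (X \<omega>) \<le> t}"
proof -
  interpret X: poisson_process M0 X "marked_intensity UNIV mu"
    by (rule poisson_process_marked) fact
  define g where "g n p = in_weight \<alpha> p * indicator (torus_box n) (fst p)" for n and p :: "(real^'d) \<times> real"
  let ?D = "\<lambda>n \<omega>. \<integral>\<^sup>+p. g n p \<partial>count_space (X \<omega>)"
  have g_meas: "g n \<in> borel_measurable (borel :: ((real^'d) \<times> real) measure)" for n
  proof -
    have [measurable]: "(torus_box n :: (real^'d) set) \<in> sets borel" by (rule torus_box_sets)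
    have [measurable]: "(fst :: (real^'d) \<times> real \<Rightarrow> _) \<in> borel_measurable borel"
      by (intro borel_measurable_continuous_onI continuous_intros)
    note [measurable] = in_weight_measurable[of \<alpha>]
    show ?thesis unfolding g_def by measurable
  qed
  have D_meas: "?D n \<in> borel_measurable M0" for n
    using X.nn_integral_points_measurable[of "g n"] g_meas[of n]
    by (simp add: space_marked_intensity measurable_cong_sets[OF sets_marked_intensity refl])
  have same_law: "measure (M n) {\<omega> \<in> space (M n). D_in_torus n \<alpha> (Xn n \<omega>) \<le> t} =
      X.prob {\<omega> \<in> space M0. ?D n \<omega> \<le> t}" if "1 \<le> n" for n
  proof -
    have "measure (M n) {\<omega> \<in> space (M n). (\<integral>\<^sup>+p. g n p * indicator (space (marked_intensity (torus_box n :: (real^'d) set) mu)) p \<partial>count_space (Xn n \<omega>)) \<le> t} =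
      X.prob {\<omega> \<in> space M0. (\<integral>\<^sup>+p. g n p * indicator (space (marked_intensity (torus_box n :: (real^'d) set) mu)) p \<partial>count_space (X \<omega>)) \<le> t}"
    proof (rule nn_integral_points_cdf_eq)
      show "poisson_process (M n) (Xn n) (marked_intensity (torus_box n) mu)"
        by (intro poisson_process_marked Mn that)
      show "poisson_process M0 X (marked_intensity UNIV mu)" by unfold_locales
      show "g n \<in> borel_measurable (marked_intensity (torus_box n) mu)"
        using g_meas by (simp add: measurable_cong_sets[OF sets_marked_intensity refl])
      \<comment> \<open>A set on which \<open>g n\<close> is nonzero lies over the box, where both
        intensities agree and are finite.\<close>
      fix A assume A: "A \<in> sets (marked_intensity (torus_box n :: (real^'d) set) mu)" "A \<subseteq> {p. g n p \<noteq> 0}"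
      have "A \<subseteq> torus_box n \<times> UNIV"
        using A(2) by (auto simp: g_def indicator_def split: if_splits)
      with A(1) show "emeasure (marked_intensity (torus_box n) mu) A = emeasure (marked_intensity UNIV mu) A \<and>
          emeasure (marked_intensity (torus_box n) mu) A < \<infinity>"
        using emeasure_marked_intensity_torus_box by (simp only: sets_marked_intensity) blast
    qed (simp add: sets_marked_intensity)
    then show ?thesis
      by (simp add: space_marked_intensity D_in_torus_eq g_def)
  qed
  have mono: "incseq g"
    using torus_box_mono
    by (auto simp: incseq_def le_fun_def g_def indicator_def split: if_splits dest: subsetD)
  have sup: "(SUP n. g n p) = in_weight \<alpha> p" for p
  proof (rule antisym)
    show "(SUP n. g n p) \<le> in_weight \<alpha> p"
      by (intro SUP_least) (auto simp: g_def indicator_def)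
    obtain n where "fst p \<in> torus_box n" using torus_box_exhausts by blast
    then have "in_weight \<alpha> p = g n p" by (simp add: g_def)
    also have "\<dots> \<le> (SUP n. g n p)" by (rule SUP_upper) simp
    finally show "in_weight \<alpha> p \<le> (SUP n. g n p)" .
  qed
  have D_sup: "D_in \<alpha> (X \<omega>) = (SUP n. ?D n \<omega>)" for \<omega>
    unfolding D_in_eq sup[symmetric]
    using mono by (intro nn_integral_monotone_convergence_SUP) auto
  have "(\<lambda>n. X.prob {\<omega> \<in> space M0. ?D n \<omega> \<le> t}) \<longlonglongrightarrow> X.prob (\<Inter>n. {\<omega> \<in> space M0. ?D n \<omega> \<le> t})"
  proof (rule X.finite_Lim_measure_decseq)
    show "range (\<lambda>n. {\<omega> \<in> space M0. ?D n \<omega> \<le> t}) \<subseteq> sets M0" using D_meas by auto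
    have "?D m \<omega> \<le> ?D n \<omega>" if "m \<le> n" for m n \<omega>
      using incseqD[OF mono that] by (intro nn_integral_mono) (auto simp: le_fun_def)
    then show "decseq (\<lambda>n. {\<omega> \<in> space M0. ?D n \<omega> \<le> t})"
      by (auto simp: decseq_def intro: order_trans)
  qed
  also have "(\<Inter>n. {\<omega> \<in> space M0. ?D n \<omega> \<le> t}) = {\<omega> \<in> space M0. D_in \<alpha> (X \<omega>) \<le> t}"
    unfolding D_sup by (auto simp: SUP_le_iff)
  finally show ?thesis
    by (rule Lim_transform_eventually) (auto intro!: eventually_sequentiallyI[of 1] simp: same_law)
qed

end

lemma cball_vol_pos: "0 < measure lborel (cball (0::real^'d) 1)"
  using content_cball_gt_0_iff[of "0::real^'d" 1] by simp

section \<open>The limiting degree: divergence, Poisson law and tail\<close>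

context heavy_mark_law
begin

text \<open>For some \<open>T \<ge> 1\<close> the far points have infinite intensity, hence almost
  surely there are infinitely many of them, each of weight at least 1.\<close>

lemma prob_D_in_infinite:
  assumes "0 \<le> \<alpha>" "s \<le> real CARD('d)" and X: "marked_poisson_pp M X (UNIV :: (real^'d) set) mu"
  shows "measure M {\<omega> \<in> space M. D_in \<alpha> (X \<omega>) = \<infinity>} = 1"
proof -
  interpret X: poisson_process M X "marked_intensity UNIV mu"
    by (rule poisson_process_marked) fact
  obtain T where T: "1 \<le> T" "(\<integral>\<^sup>+u. ennreal (measure lborel (cball (0::real^'d) 1) * (real CARD('d) * u ^ (CARD('d) - 1))) *
      emeasure mu {u..} * indicator {T..} u \<partial>lborel) = \<infinity>"
    using radial_integral_infinite[OF zero_less_card_finite cball_vol_pos[where 'd='d] assms(2)] by (auto simp: card_gt_0_iff)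
  let ?F = "far_points T :: ((real^'d) \<times> real) set"
  have F: "?F \<in> sets (marked_intensity UNIV mu)" "emeasure (marked_intensity UNIV mu) ?F = \<infinity>"
    using T emeasure_far_points[of T, where 'd='d] by (auto simp: sets_marked_intensity far_points_sets)
  have sf: "sigma_finite_measure (marked_intensity (UNIV :: (real^'d) set) mu)"
    unfolding marked_intensity_UNIV by (rule pair.sigma_finite_measure_axioms)
  have "D_in \<alpha> P = \<infinity>" if "npts P ?F = \<infinity>" for P
  proof -
    have "\<infinity> = (\<integral>\<^sup>+p. indicator ?F p \<partial>count_space P)"
      using that by (simp only: nn_integral_count_space_indicator_npts ennreal_of_enat_infty)
    also have "\<dots> \<le> D_in \<alpha> P"
      unfolding D_in_eq
    proof (intro nn_integral_mono)
      fix p :: "(real^'d) \<times> real"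
      have "1 \<le> in_weight \<alpha> p" if p: "p \<in> ?F"
      proof -
        have "1 \<le> norm (fst p)" using p T(1) by (auto simp: far_points_def)
        then have "1 \<le> pw (norm (fst p)) \<alpha>"
          using assms(1) by (simp add: pw_def ge_one_powr_ge_zero)
        then show ?thesis
          using p by (simp add: in_weight_covering covering_points_def far_points_def)
      qed
      then show "indicator ?F p \<le> in_weight \<alpha> p" by (simp add: indicator_def)
    qed
    finally show ?thesis by (simp add: top_unique)
  qed
  then have "X.prob {\<omega> \<in> space M. npts (X \<omega>) ?F = \<infinity>} \<le> X.prob {\<omega> \<in> space M. D_in \<alpha> (X \<omega>) = \<infinity>}"
    using D_in_measurable[OF X] by (intro X.finite_measure_mono) auto
  then show ?thesis
    using X.prob_npts_eq_infinity[OF sf F] by (intro antisym) auto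
qed

text \<open>A covering point lies in a ball of radius \<open>T\<close>, which has finite volume, or
  is a far point beyond \<open>T\<close>; for large \<open>T\<close> the latter have finite
  intensity.\<close>

lemma emeasure_covering_points_finite:
  assumes "real CARD('d) < s"
  shows "emeasure (marked_intensity UNIV mu) (covering_points :: ((real^'d) \<times> real) set) < \<infinity>"
proof -
  let ?N = "marked_intensity (UNIV :: (real^'d) set) mu"
  obtain T where T: "0 \<le> T" "emeasure ?N (far_points T) < \<infinity>"
  proof -
    have "\<forall>\<^sub>F T in at_top. 0 \<le> T \<and> emeasure ?N (far_points T) < \<infinity>"
      using radial_integral_asymp(1)[OF zero_less_card_finite cball_vol_pos[where 'd='d] assms] eventually_ge_at_top[of 0]
      by eventually_elim (auto simp: emeasure_far_points)
    then show ?thesis using that by (auto simp: eventually_at_top_linorder)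
  qed
  have sets: "cball 0 T \<times> UNIV \<in> sets ?N" "far_points T \<in> sets ?N"
    by (auto simp: sets_marked_intensity far_points_sets intro!: borel_closed closed_Times)
  have "emeasure ?N covering_points \<le> emeasure ?N (cball 0 T \<times> UNIV \<union> far_points T)"
    using sets by (intro emeasure_mono) (auto simp: covering_points_def far_points_def)
  also have "\<dots> \<le> emeasure ?N (cball 0 T \<times> UNIV) + emeasure ?N (far_points T)"
    using sets by (rule emeasure_subadditive)
  also have "emeasure ?N (cball 0 T \<times> UNIV) = emeasure lborel (cball (0::real^'d) T)"
    using mark.emeasure_space_1 sets_eq_imp_space_eq[OF sets_mu]
    by (simp add: marked_intensity_UNIV mark.emeasure_pair_measure_Times sets_mu)
  also have "\<dots> + emeasure ?N (far_points T) < \<infinity>"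
    using T by (simp add: emeasure_lborel_cball_0)
  finally show ?thesis .
qed

text \<open>For \<alpha> = 0 the degree is the number of covering points, a set of finite
  intensity.\<close>

lemma D_in_0_poisson:
  assumes "real CARD('d) < s" "emeasure mu {..<0} = 0" and X: "marked_poisson_pp M X (UNIV :: (real^'d) set) mu"
  shows "measure M {\<omega> \<in> space M. D_in 0 (X \<omega>) = of_nat k} =
    poisson_prob (measure lborel (cball (0::real^'d) 1) * (\<integral>r. r ^ CARD('d) \<partial>mu)) k"
proof -
  interpret X: poisson_process M X "marked_intensity UNIV mu"
    by (rule poisson_process_marked) fact
  have "D_in 0 P = ennreal_of_enat (npts P covering_points)" for P :: "((real^'d) \<times> real) set"
    unfolding D_in_eq nn_integral_count_space_indicator_npts[symmetric]
    by (intro nn_integral_cong) (simp add: in_weight_covering pw_def)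
  then have "D_in 0 P = of_nat k \<longleftrightarrow> npts P covering_points = enat k" for P :: "((real^'d) \<times> real) set"
    by (simp only: ennreal_of_enat_enat[symmetric] ennreal_of_enat_inj)
  then show ?thesis
    using X.prob_npts[OF _ emeasure_covering_points_finite[OF assms(1)], of k]
      measure_covering_points[OF assms(2), where 'd='d]
    by (simp add: sets_marked_intensity covering_points_sets)
qed

text \<open>The intensity of weights above \<open>t\<close> is that of the far points beyond
  \<open>t powr (1 / \<alpha>)\<close>, of order \<open>t powr (- (s - d) / \<alpha>)\<close>; the
  largest term then determines the tail of the sum.\<close>

lemma D_in_tail:
  assumes "0 < \<alpha>" "real CARD('d) < s" and X: "marked_poisson_pp M X (UNIV :: (real^'d) set) mu"
  shows "((\<lambda>t. t powr ((s - real CARD('d)) / \<alpha>) * measure M {\<omega> \<in> space M. D_in \<alpha> (X \<omega>) > ennreal t})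
    \<longlongrightarrow> real CARD('d) * measure lborel (cball (0::real^'d) 1) * \<beta> / (s - real CARD('d))) at_top"
proof -
  let ?N = "marked_intensity (UNIV :: (real^'d) set) mu" and ?q = "s - real CARD('d)"
  let ?c = "real CARD('d) * measure lborel (cball (0::real^'d) 1) * \<beta> / (s - real CARD('d))"
  interpret X: poisson_process M X ?N
    by (rule poisson_process_marked) fact
  have "((\<lambda>T. T powr ?q * enn2real (\<integral>\<^sup>+u. ennreal (measure lborel (cball (0::real^'d) 1) * (real CARD('d) * u ^ (CARD('d) - 1))) *
      emeasure mu {u..} * indicator {T..} u \<partial>lborel)) \<longlongrightarrow> ?c) at_top"
    using radial_integral_asymp(2)[OF zero_less_card_finite cball_vol_pos[where 'd='d] assms(2)] by (simp add: card_gt_0_iff mult_ac)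
  moreover have "\<forall>\<^sub>F T in at_top. T powr ?q * enn2real (\<integral>\<^sup>+u. ennreal (measure lborel (cball (0::real^'d) 1) * (real CARD('d) * u ^ (CARD('d) - 1))) *
      emeasure mu {u..} * indicator {T..} u \<partial>lborel) = T powr ?q * measure ?N (far_points T)"
    using eventually_ge_at_top[of 0]
    by eventually_elim (simp add: emeasure_far_points measure_def[of ?N])
  ultimately have "((\<lambda>T. T powr ?q * measure ?N (far_points T)) \<longlongrightarrow> ?c) at_top"
    by (rule Lim_transform_eventually)
  moreover have "filterlim (\<lambda>t. t powr (1 / \<alpha>)) at_top at_top"
    using assms(1) by real_asymp
  \<comment> \<open>Substitutes \<open>T = t powr (1 / \<alpha>)\<close> into the asymptotics of the
    far points.\<close>
  ultimately have "((\<lambda>t. (t powr (1 / \<alpha>)) powr ?q * measure ?N (far_points (t powr (1 / \<alpha>)))) \<longlongrightarrow> ?c) at_top"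
    by (rule filterlim_compose)
  moreover have "\<forall>\<^sub>F t in at_top. (t powr (1 / \<alpha>)) powr ?q * measure ?N (far_points (t powr (1 / \<alpha>))) =
      t powr (?q / \<alpha>) * measure ?N {p. ennreal t < in_weight \<alpha> p}"
    using eventually_gt_at_top[of 0]
    by eventually_elim (simp add: in_weight_superlevel assms(1) powr_powr)
  ultimately have lim: "((\<lambda>t. t powr (?q / \<alpha>) * measure ?N {p. ennreal t < in_weight \<alpha> p}) \<longlongrightarrow> ?c) at_top"
    by (rule Lim_transform_eventually)
  show ?thesis
    unfolding D_in_eq
  proof (rule X.prob_sum_gt_asymp[OF _ _ emeasure_covering_points_finite[OF assms(2)] _ _ lim])
    show "in_weight \<alpha> \<in> borel_measurable ?N"
      using in_weight_measurable by (simp add: measurable_cong_sets[OF sets_marked_intensity refl])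
  qed (use assms in \<open>auto simp: sets_marked_intensity covering_points_sets in_weight_covering\<close>)
qed

end

theorem theorem2p2:
  fixes \<alpha> \<beta> s :: real
    and mu :: "real measure"
    and M :: "nat \<Rightarrow> 'a measure" and Xn :: "nat \<Rightarrow> 'a \<Rightarrow> ((real^'d) \<times> real) set"
    and M0 :: "'b measure" and X :: "'b \<Rightarrow> ((real^'d) \<times> real) set"
  assumes dim: "CARD('d) \<ge> 2"
    and alpha: "\<alpha> \<ge> 0"
    and beta: "\<beta> > 0" and s_pos: "s > 0"
    and mu_prob: "prob_space mu" and mu_sets: "sets mu = sets borel"
    and mu_nonneg: "emeasure mu {..<0} = 0"
    and mu_ac: "absolutely_continuous lborel mu"
    and tail: "((\<lambda>h. h powr s * measure mu {h<..}) \<longlongrightarrow> \<beta>) at_top"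
    and Xn_pp: "\<And>n. n \<ge> 1 \<Longrightarrow> marked_poisson_pp (M n) (Xn n) (torus_box n) mu"
    and X_pp: "marked_poisson_pp M0 X UNIV mu"
  shows
    "conv_distr_ennreal M (\<lambda>n \<omega>. D_in_torus n \<alpha> (Xn n \<omega>)) M0 (\<lambda>\<omega>. D_in \<alpha> (X \<omega>))
     \<and> (s \<le> real CARD('d) \<longrightarrow> measure M0 {\<omega> \<in> space M0. D_in \<alpha> (X \<omega>) = \<infinity>} = 1)
     \<and> (s > real CARD('d) \<longrightarrow>
          (\<forall>k::nat. measure M0 {\<omega> \<in> space M0. D_in 0 (X \<omega>) = of_nat k}
             = poisson_prob (measure lborel (cball (0::real^'d) 1) * (\<integral>r. r ^ CARD('d) \<partial>mu)) k))
     \<and> (\<alpha> > 0 \<and> s > real CARD('d) \<longrightarrow>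
          ((\<lambda>t. t powr ((s - real CARD('d)) / \<alpha>)
                 * measure M0 {\<omega> \<in> space M0. D_in \<alpha> (X \<omega>) > ennreal t})
            \<longlongrightarrow> real CARD('d) * measure lborel (cball (0::real^'d) 1) * \<beta> / (s - real CARD('d)))
           at_top)"
proof -
  interpret mark: prob_space mu by fact
  interpret heavy_mark_law mu \<beta> s
    by unfold_locales (use mu_sets beta mu_ac tail in auto)
  have "conv_distr_ennreal M (\<lambda>n \<omega>. D_in_torus n \<alpha> (Xn n \<omega>)) M0 (\<lambda>\<omega>. D_in \<alpha> (X \<omega>))"
    unfolding conv_distr_ennreal_def using D_in_torus_conv[OF Xn_pp X_pp] by blast
  then show ?thesis
    using prob_D_in_infinite[OF alpha _ X_pp] D_in_0_poisson[OF _ mu_nonneg X_pp] D_in_tail[OF _ _ X_pp]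
    by blast
qed

end
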